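(* Let $X$ be an arbitrary Coxeter graph. Let $w\in W_c(X)$ and $s\in S(X)$ be such that $w>ws\in W_c(X)$. Then, for all $x\in W_c(X)$ with $x\le w$, $$a_{x,w}=\widetilde{a_{x,w}}+\sum_{\substack{y\in W_c(X),\ ys\notin W_c(X)\\ ys>y}} D_{x,ys}\,a_{y,ws},$$ where $$\widetilde{a_{x,w}}=\begin{cases} a_{xs,ws} & \text{if } x>xs,\\ q\,a_{xs,ws}+(1-q)\,a_{x,ws} & \text{if } x<xs\in W_c(X),\\ (1-q)\,a_{x,ws} & \text{if } x<xs\notin W_c(X).\end{cases}$$
   Context: Let $X$ be a Coxeter graph, $W(X)$ its Coxeter group with generating set $S(X)$, length function $\ell$, Bruhat order $\le$ and identity $e$. Let $\mathcal A=\mathbb Z[q^{1/2},q^{-1/2}]$. The Hecke algebra $\mathcal H(X)$ is the associative $\mathcal A$-algebra with linear basis $\{T_w: w\in W(X)\}$, identity $T_e$, and $T_wT_s=T_{ws}$ if $\ell(ws)>\ell(w)$, $T_wT_s=qT_{ws}+(q-1)T_w$ if $\ell(ws)<\ell(w)$ ($s\in S(X)$). Let $J(X)$ be the two-sided ideal generated by all $\sum_{w\in\langle s_i,s_j\rangle}T_w$, where $(s_i,s_j)$ runs over pairs of non-commuting generators in $S(X)$ such that $s_is_j$ has finite order. The generalized Temperley--Lieb algebra is $TL(X)=\mathcal H(X)/J(X)$; let $\sigma$ be the canonical projection and $t_w=\sigma(T_w)$ for $w\in W(X)$. An element $w$ is fully commutative if any reduced expression for $w$ can be obtained from any other by using only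 Coxeter relations involving commuting generators; $W_c(X)$ is the set of such elements. It is known that $\{t_w: w\in W_c(X)\}$ is an $\mathcal A$-basis of $TL(X)$. Polynomials $D_{x,w}$: for $w\in W(X)$, the polynomials $D_{x,w}=D_{x,w}(q)\in\mathbb Z[q]$ ($x\in W_c(X)$) are the unique ones with $t_w=\sum_{x\in W_c(X),\,x\le w}D_{x,w}(q)\,t_x$, and $D_{x,w}=0$ if $x\not\le w$. Polynomials $a_{y,w}$: for $w\in W_c(X)$, the polynomials $a_{y,w}=a_{y,w}(q)\in\mathbb Z[q]$ ($y\in W_c(X)$) are the unique ones with $(t_{w^{-1}})^{-1}=q^{-\ell(w)}\sum_{y\in W_c(X),\,y\le w}a_{y,w}(q)\,t_y$ (so $a_{w,w}=1$); $a_{y,w}=0$ if $y\not\le w$. *)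

theory Defs
  imports
    "HOL-Library.Extended_Nat"
    "HOL-Library.Poly_Mapping"
    "HOL-Computational_Algebra.Polynomial"
    "HOL-Algebra.QuotRing"
    "HOL-Algebra.Generated_Groups"
    "HOL-Algebra.Module"
begin

section \<open>Coxeter graphs and Coxeter groups\<close>

text \<open>
  A Coxeter graph is encoded by its matrix of edge labels: the vertices are the elements of the
  (possibly infinite) type \<^typ>\<open>'s\<close>; distinct vertices \<open>s\<close>, \<open>t\<close> are not joined if
  \<open>m s t = 2\<close>, joined by an unlabelled edge if \<open>m s t = 3\<close>, and joined by an edge with label
  \<open>m s t\<close> if \<open>m s t \<ge> 4\<close>, where the label \<open>\<infinity>\<close> is allowed.
\<close>

definition coxeter_graph :: "('s \<Rightarrow> 's \<Rightarrow> enat) \<Rightarrow> bool" where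
  "coxeter_graph m \<longleftrightarrow>
     (\<forall>s. m s s = 1) \<and> (\<forall>s t. m s t = m t s) \<and> (\<forall>s t. s \<noteq> t \<longrightarrow> 2 \<le> m s t)"

text \<open>
  The Coxeter group is given by the generators \<open>s\<close> and the relations \<open>(s t)\<^bsup>m s t\<^esup> = 1\<close> for finite \<open>m s t\<close>.
  The relations \<open>s\<^sup>2 = 1\<close> (the case \<open>s = t\<close>) make the generators self-inverse, so the group
  presentation agrees with the monoid presentation, and group elements are classes of words.
\<close>

inductive word_eq :: "('s \<Rightarrow> 's \<Rightarrow> enat) \<Rightarrow> 's list \<Rightarrow> 's list \<Rightarrow> bool" for m where
  relator: "m s t = enat n \<Longrightarrow> word_eq m (u @ concat (replicate n [s, t]) @ v) (u @ v)"
| refl: "word_eq m u u"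
| sym: "word_eq m u v \<Longrightarrow> word_eq m v u"
| trans: "word_eq m u v \<Longrightarrow> word_eq m v w \<Longrightarrow> word_eq m u w"

definition word_class :: "('s \<Rightarrow> 's \<Rightarrow> enat) \<Rightarrow> 's list \<Rightarrow> 's list set" where
  "word_class m u = {v. word_eq m u v}"

definition coxeter_group :: "('s \<Rightarrow> 's \<Rightarrow> enat) \<Rightarrow> 's list set monoid" where
  "coxeter_group m =
     \<lparr>carrier = range (word_class m),
      mult = (\<lambda>A B. \<Union>u\<in>A. \<Union>v\<in>B. word_class m (u @ v)),
      one = word_class m []\<rparr>"

definition generators :: "('s \<Rightarrow> 's \<Rightarrow> enat) \<Rightarrow> 's list set set" where
  "generators m = range (\<lambda>s. word_class m [s])"

text \<open>A group element is the set of all words that represent it.\<close>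

definition cox_length :: "'s list set \<Rightarrow> nat" where
  "cox_length w = (LEAST n. \<exists>u\<in>w. length u = n)"

definition reduced_words :: "'s list set \<Rightarrow> 's list set" where
  "reduced_words w = {u \<in> w. length u = cox_length w}"

definition reflections :: "('s \<Rightarrow> 's \<Rightarrow> enat) \<Rightarrow> 's list set set" where
  "reflections m =
     {g \<otimes>\<^bsub>coxeter_group m\<^esub> s \<otimes>\<^bsub>coxeter_group m\<^esub> inv\<^bsub>coxeter_group m\<^esub> g | g s.
        g \<in> carrier (coxeter_group m) \<and> s \<in> generators m}"

definition bruhat_le :: "('s \<Rightarrow> 's \<Rightarrow> enat) \<Rightarrow> 's list set \<Rightarrow> 's list set \<Rightarrow> bool" where
  "bruhat_le m x w \<longleftrightarrow>
     (x, w) \<in> {(u, u \<otimes>\<^bsub>coxeter_group m\<^esub> r) | u r.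
       u \<in> carrier (coxeter_group m) \<and> r \<in> reflections m \<and>
       cox_length u < cox_length (u \<otimes>\<^bsub>coxeter_group m\<^esub> r)}\<^sup>*"

definition bruhat_less :: "('s \<Rightarrow> 's \<Rightarrow> enat) \<Rightarrow> 's list set \<Rightarrow> 's list set \<Rightarrow> bool" where
  "bruhat_less m x w \<longleftrightarrow> bruhat_le m x w \<and> x \<noteq> w"

definition commutation_step :: "('s \<Rightarrow> 's \<Rightarrow> enat) \<Rightarrow> ('s list \<times> 's list) set" where
  "commutation_step m = {(u @ [s, t] @ v, u @ [t, s] @ v) | u v s t. m s t = 2}"

definition fully_commutative :: "('s \<Rightarrow> 's \<Rightarrow> enat) \<Rightarrow> 's list set set" where
  "fully_commutative m =
     {w \<in> carrier (coxeter_group m).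
        \<forall>u\<in>reduced_words w. \<forall>v\<in>reduced_words w. (u, v) \<in> (commutation_step m)\<^sup>*}"


section \<open>The ground ring\<close>

text \<open>
  \<open>\<int>[q\<^bsup>1/2\<^esup>, q\<^bsup>-1/2\<^esup>]\<close> is the ring of finitely supported functions \<open>\<int> \<rightarrow> \<int>\<close> under convolution; the
  exponent \<open>k\<close> stands for \<open>q\<^bsup>k/2\<^esup>\<close>.
\<close>

type_synonym laurent = "int \<Rightarrow>\<^sub>0 int"

definition laurent_ring :: "laurent ring" where
  "laurent_ring = \<lparr>carrier = UNIV, mult = (*), one = 1, zero = 0, add = (+)\<rparr>"

definition q_pow :: "int \<Rightarrow> laurent" where
  "q_pow k = Poly_Mapping.single (2 * k) 1"

definition of_poly :: "int poly \<Rightarrow> laurent" where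
  "of_poly p = poly (map_poly of_int p) (q_pow 1)"


section \<open>The Hecke algebra and the generalized Temperley--Lieb algebra\<close>

definition linear_basis ::
  "(laurent, 'h) module \<Rightarrow> 'i set \<Rightarrow> ('i \<Rightarrow> 'h) \<Rightarrow> bool" where
  "linear_basis M I b \<longleftrightarrow>
     b \<in> I \<rightarrow> carrier M \<and>
     (\<forall>h\<in>carrier M. \<exists>!c. finite {i. c i \<noteq> 0} \<and> {i. c i \<noteq> 0} \<subseteq> I \<and>
        h = finsum M (\<lambda>i. c i \<odot>\<^bsub>M\<^esub> b i) {i. c i \<noteq> 0})"

definition associative_algebra :: "(laurent, 'h) module \<Rightarrow> bool" where
  "associative_algebra M \<longleftrightarrow>
     module laurent_ring M \<and> ring M \<and>
     (\<forall>a. \<forall>x\<in>carrier M. \<forall>y\<in>carrier M.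
        (a \<odot>\<^bsub>M\<^esub> x) \<otimes>\<^bsub>M\<^esub> y = a \<odot>\<^bsub>M\<^esub> (x \<otimes>\<^bsub>M\<^esub> y) \<and>
        x \<otimes>\<^bsub>M\<^esub> (a \<odot>\<^bsub>M\<^esub> y) = a \<odot>\<^bsub>M\<^esub> (x \<otimes>\<^bsub>M\<^esub> y))"

text \<open>These conditions determine the algebra \<open>H\<close> with its basis \<open>T\<close> up to unique isomorphism.\<close>

definition hecke_algebra ::
  "('s \<Rightarrow> 's \<Rightarrow> enat) \<Rightarrow> (laurent, 'h) module \<Rightarrow> ('s list set \<Rightarrow> 'h) \<Rightarrow> bool" where
  "hecke_algebra m H T \<longleftrightarrow>
     associative_algebra H \<and>
     linear_basis H (carrier (coxeter_group m)) T \<and>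
     \<one>\<^bsub>H\<^esub> = T \<one>\<^bsub>coxeter_group m\<^esub> \<and>
     (\<forall>w\<in>carrier (coxeter_group m). \<forall>s\<in>generators m.
        let ws = w \<otimes>\<^bsub>coxeter_group m\<^esub> s in
        (cox_length ws > cox_length w \<longrightarrow> T w \<otimes>\<^bsub>H\<^esub> T s = T ws) \<and>
        (cox_length ws < cox_length w \<longrightarrow>
           T w \<otimes>\<^bsub>H\<^esub> T s = (q_pow 1 \<odot>\<^bsub>H\<^esub> T ws) \<oplus>\<^bsub>H\<^esub> ((q_pow 1 - 1) \<odot>\<^bsub>H\<^esub> T w)))"

definition TL_ideal ::
  "('s \<Rightarrow> 's \<Rightarrow> enat) \<Rightarrow> (laurent, 'h) module \<Rightarrow> ('s list set \<Rightarrow> 'h) \<Rightarrow> 'h set" where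
  "TL_ideal m H T =
     Idl\<^bsub>H\<^esub> {finsum H T (generate (coxeter_group m) {s, t}) | s t.
       s \<in> generators m \<and> t \<in> generators m \<and>
       s \<otimes>\<^bsub>coxeter_group m\<^esub> t \<noteq> t \<otimes>\<^bsub>coxeter_group m\<^esub> s \<and>
       (\<exists>n::nat. 0 < n \<and>
          (s \<otimes>\<^bsub>coxeter_group m\<^esub> t) [^]\<^bsub>coxeter_group m\<^esub> n = \<one>\<^bsub>coxeter_group m\<^esub>)}"

text \<open>
  The library quotient \<^const>\<open>FactRing\<close> carries only the ring structure; the scalar action
  \<open>a (h + J) = a h + J\<close> is added here.
\<close>

definition TL_algebra ::
  "('s \<Rightarrow> 's \<Rightarrow> enat) \<Rightarrow> (laurent, 'h) module \<Rightarrow> ('s list set \<Rightarrow> 'h) \<Rightarrow>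
   (laurent, 'h set) module" where
  "TL_algebra m H T =
     (let J = TL_ideal m H T; Q = H Quot J in
      \<lparr>carrier = carrier Q, mult = mult Q, one = one Q, zero = zero Q, add = add Q,
       smult = (\<lambda>a C. \<Union>h\<in>C. J +>\<^bsub>H\<^esub> (a \<odot>\<^bsub>H\<^esub> h))\<rparr>)"

definition TL_elt ::
  "('s \<Rightarrow> 's \<Rightarrow> enat) \<Rightarrow> (laurent, 'h) module \<Rightarrow> ('s list set \<Rightarrow> 'h) \<Rightarrow>
   's list set \<Rightarrow> 'h set" where
  "TL_elt m H T w = TL_ideal m H T +>\<^bsub>H\<^esub> T w"


section \<open>The polynomials D and a\<close>

definition fc_below :: "('s \<Rightarrow> 's \<Rightarrow> enat) \<Rightarrow> 's list set \<Rightarrow> 's list set set" where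
  "fc_below m w = {x \<in> fully_commutative m. bruhat_le m x w}"

definition TL_sum ::
  "('s \<Rightarrow> 's \<Rightarrow> enat) \<Rightarrow> (laurent, 'h) module \<Rightarrow> ('s list set \<Rightarrow> 'h) \<Rightarrow>
   's list set \<Rightarrow> ('s list set \<Rightarrow> int poly) \<Rightarrow> 'h set" where
  "TL_sum m H T w f =
     finsum (TL_algebra m H T)
       (\<lambda>x. of_poly (f x) \<odot>\<^bsub>TL_algebra m H T\<^esub> TL_elt m H T x) (fc_below m w)"

text \<open>
  The families \<open>D\<close> and \<open>a\<close> are characterized as the unique ones satisfying their defining
  equations, the lower index being the first argument. Only values at fully commutative lower
  indices (and, for \<open>a\<close>, fully commutative upper indices) are meaningful.
\<close>

definition is_D_family ::
  "('s \<Rightarrow> 's \<Rightarrow> enat) \<Rightarrow> (laurent, 'h) module \<Rightarrow> ('s list set \<Rightarrow> 'h) \<Rightarrow>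
   ('s list set \<Rightarrow> 's list set \<Rightarrow> int poly) \<Rightarrow> bool" where
  "is_D_family m H T D \<longleftrightarrow>
     (\<forall>w\<in>carrier (coxeter_group m).
        TL_elt m H T w = TL_sum m H T w (\<lambda>x. D x w) \<and>
        (\<forall>f. TL_elt m H T w = TL_sum m H T w f \<longrightarrow> (\<forall>x\<in>fc_below m w. f x = D x w)) \<and>
        (\<forall>x\<in>fully_commutative m. \<not> bruhat_le m x w \<longrightarrow> D x w = 0))"

definition is_a_family ::
  "('s \<Rightarrow> 's \<Rightarrow> enat) \<Rightarrow> (laurent, 'h) module \<Rightarrow> ('s list set \<Rightarrow> 'h) \<Rightarrow>
   ('s list set \<Rightarrow> 's list set \<Rightarrow> int poly) \<Rightarrow> bool" where
  "is_a_family m H T a \<longleftrightarrow>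
     (\<forall>w\<in>fully_commutative m.
        let t_inv = inv\<^bsub>TL_algebra m H T\<^esub> TL_elt m H T (inv\<^bsub>coxeter_group m\<^esub> w);
            expansion = (\<lambda>f. q_pow (- int (cox_length w)) \<odot>\<^bsub>TL_algebra m H T\<^esub> TL_sum m H T w f)
        in t_inv = expansion (\<lambda>y. a y w) \<and>
           (\<forall>f. t_inv = expansion f \<longrightarrow> (\<forall>y\<in>fc_below m w. f y = a y w)) \<and>
           (\<forall>y\<in>fully_commutative m. \<not> bruhat_le m y w \<longrightarrow> a y w = 0))"

text \<open>
  The last branch is \<open>x < xs\<close> with \<open>xs\<close> not fully commutative, since \<open>x\<close> and \<open>xs\<close> are always
  comparable and distinct.
\<close>

definition a_tilde ::
  "('s \<Rightarrow> 's \<Rightarrow> enat) \<Rightarrow> ('s list set \<Rightarrow> 's list set \<Rightarrow> int poly) \<Rightarrow>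
   's list set \<Rightarrow> 's list set \<Rightarrow> 's list set \<Rightarrow> int poly" where
  "a_tilde m a s x w =
     (let q = [:0, 1:];
          xs = x \<otimes>\<^bsub>coxeter_group m\<^esub> s;
          ws = w \<otimes>\<^bsub>coxeter_group m\<^esub> s
      in if bruhat_less m xs x then a xs ws
         else if bruhat_less m x xs \<and> xs \<in> fully_commutative m
           then q * a xs ws + (1 - q) * a x ws
         else (1 - q) * a x ws)"

end

theory Submission
  imports Defs
begin

text \<open>
  Write \<open>w = (ws) s\<close> with \<open>ws < w\<close>. Then \<open>t\<^bsub>w\<inverse>\<^esub> = t\<^sub>s t\<^bsub>(ws)\<inverse>\<^esub>\<close>, so the inverse of
  \<open>t\<^bsub>w\<inverse>\<^esub>\<close> is the inverse of \<open>t\<^bsub>(ws)\<inverse>\<^esub>\<close> times \<open>t\<^sub>s\<inverse> = q\<inverse> (t\<^sub>s + (1 - q))\<close>. Expanding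
  the first factor by the definition of the polynomials \<open>a\<close>, this inverse is \<open>q\<close> to the power \<open>-\<ell>(w)\<close>
  times the sum over \<open>y \<le> ws\<close> of \<open>a y (ws)\<close> times \<open>t\<^sub>y t\<^sub>s + (1 - q) t\<^sub>y\<close>, and the last element is
  \<^item> \<open>q t\<^bsub>ys\<^esub>\<close>, if \<open>ys < y\<close>: the quadratic relation produces \<open>(q - 1) t\<^sub>y\<close>, which cancels;
  \<^item> \<open>t\<^bsub>ys\<^esub> + (1 - q) t\<^sub>y\<close>, if \<open>y < ys\<close>; when \<open>ys\<close> is not fully commutative, \<open>t\<^bsub>ys\<^esub>\<close> is expanded by
    the polynomials \<open>D\<close>.
  The coefficient of \<open>t\<^sub>x\<close> collects contributions of \<open>y = xs\<close> and \<open>y = x\<close>, which make up the first term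
  of the recursion, and of the \<open>y\<close> with \<open>ys\<close> not fully commutative, which make up the sum.

  The uniqueness clause in the definition of \<open>a\<close> then identifies the coefficients. It speaks of sums over
  the fully commutative elements below \<open>w\<close>, so three facts about Coxeter groups are required: if
  \<open>y \<le> ws < w\<close>, then \<open>ys \<le> w\<close> (the lifting property); Bruhat intervals are finite; and if \<open>y\<close> is fully
  commutative with \<open>ys < y\<close>, then \<open>ys\<close> is fully commutative. The first two follow from the strong exchange
  property, which is derived here from the presentation of the group: for a word, the parity of the number
  of times that a given reflection occurs among the reflections attached to its letters depends only on the
  group element, since the \<open>2n\<close> reflections of a relator \<open>(s t)\<^sup>n\<close> are \<open>n\<close> reflections, each listed
  twice. The third follows by deleting the last occurrence of the letter \<open>s\<close> from a chain of commutations.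
\<close>

section \<open>Words and group elements\<close>

locale coxeter =
  fixes m :: "'s \<Rightarrow> 's \<Rightarrow> enat"
  assumes coxeter_graph: "coxeter_graph m"
begin

abbreviation W :: "'s list set monoid" where "W \<equiv> coxeter_group m"

abbreviation val :: "'s list \<Rightarrow> 's list set" where "val \<equiv> word_class m"

lemma word_eq_context: "word_eq m u v \<Longrightarrow> word_eq m (a @ u @ b) (a @ v @ b)"
proof (induction rule: word_eq.induct)
  case (relator s t n u v)
  then show ?case using word_eq.relator[of m s t n "a @ u" "v @ b"] by simp
qed (assumption | rule word_eq.refl | erule word_eq.sym | erule (1) word_eq.trans)+

lemma word_eq_append: "word_eq m u u' \<Longrightarrow> word_eq m v v' \<Longrightarrow> word_eq m (u @ v) (u' @ v')"
  using word_eq_context[of u u' "[]" v] word_eq_context[of v v' u' "[]"]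
  by (metis append_Nil append_Nil2 word_eq.trans)

lemma val_eq_iff: "val u = val v \<longleftrightarrow> word_eq m u v"
  unfolding word_class_def set_eq_iff mem_Collect_eq
  by (metis word_eq.refl word_eq.sym word_eq.trans)

lemma mem_val_iff: "v \<in> val u \<longleftrightarrow> val v = val u"
  unfolding val_eq_iff unfolding word_class_def by (blast intro: word_eq.sym)

lemma val_in_carrier [simp]: "val u \<in> carrier W"
  by (simp add: coxeter_group_def)

lemma in_carrierE:
  assumes "g \<in> carrier W" obtains u where "g = val u"
  using assms by (auto simp: coxeter_group_def)

lemma val_mult [simp]: "val u \<otimes>\<^bsub>W\<^esub> val v = val (u @ v)"
proof -
  have "val (u' @ v') = val (u @ v)" if "u' \<in> val u" "v' \<in> val v" for u' v'
    using that word_eq_append unfolding mem_val_iff val_eq_iff by blast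
  moreover have "u \<in> val u" "v \<in> val v"
    by (simp_all add: mem_val_iff)
  ultimately have "(\<Union>u'\<in>val u. \<Union>v'\<in>val v. val (u' @ v')) = val (u @ v)" by blast
  then show ?thesis
    by (simp add: coxeter_group_def)
qed

lemma one_val: "\<one>\<^bsub>W\<^esub> = val []"
  by (simp add: coxeter_group_def)

lemma val_square: "val [s, s] = val []"
proof -
  have "m s s = enat 1"
    using coxeter_graph by (simp add: coxeter_graph_def one_enat_def)
  then show ?thesis
    using word_eq.relator[of m s s 1 "[]" "[]"] by (simp add: val_eq_iff)
qed

lemma val_mult_rev: "val (rev u @ u) = val []"
proof (induction u)
  case (Cons s u)
  have "val (rev (s # u) @ s # u) = val (rev u) \<otimes>\<^bsub>W\<^esub> val [s, s] \<otimes>\<^bsub>W\<^esub> val u"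
    by simp
  then show ?case by (simp only: val_square) (simp add: Cons)
qed simp

sublocale grp: group W
proof (rule groupI)
  fix x y z assume xyz: "x \<in> carrier W" "y \<in> carrier W" "z \<in> carrier W"
  obtain u where u: "x = val u" using xyz(1) by (rule in_carrierE)
  obtain v where v: "y = val v" using xyz(2) by (rule in_carrierE)
  obtain t where t: "z = val t" using xyz(3) by (rule in_carrierE)
  show "x \<otimes>\<^bsub>W\<^esub> y \<in> carrier W" "x \<otimes>\<^bsub>W\<^esub> y \<otimes>\<^bsub>W\<^esub> z = x \<otimes>\<^bsub>W\<^esub> (y \<otimes>\<^bsub>W\<^esub> z)"
    by (simp_all add: u v t)
next
  fix x assume "x \<in> carrier W"
  then obtain u where u: "x = val u" by (rule in_carrierE)
  show "\<one>\<^bsub>W\<^esub> \<otimes>\<^bsub>W\<^esub> x = x" by (simp add: u one_val)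
  show "\<exists>y\<in>carrier W. y \<otimes>\<^bsub>W\<^esub> x = \<one>\<^bsub>W\<^esub>"
    by (rule bexI[of _ "val (rev u)"]) (simp_all add: u one_val val_mult_rev)
qed (simp add: one_val)

lemma inv_val [simp]: "inv\<^bsub>W\<^esub> (val u) = val (rev u)"
  by (rule grp.inv_equality) (simp_all add: val_mult_rev one_val)

lemma generatorE:
  assumes "s \<in> generators m" obtains c where "s = val [c]"
  using assms by (auto simp: generators_def)

lemma generator_in_carrier [simp]: "s \<in> generators m \<Longrightarrow> s \<in> carrier W"
  by (erule generatorE) simp

lemma generator_square: "s \<in> generators m \<Longrightarrow> s \<otimes>\<^bsub>W\<^esub> s = \<one>\<^bsub>W\<^esub>"
  by (erule generatorE) (simp add: val_square one_val)

lemma inv_generator: "s \<in> generators m \<Longrightarrow> inv\<^bsub>W\<^esub> s = s"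
  by (erule generatorE) simp

lemma mult_generator_twice:
  "g \<in> carrier W \<Longrightarrow> s \<in> generators m \<Longrightarrow> g \<otimes>\<^bsub>W\<^esub> s \<otimes>\<^bsub>W\<^esub> s = g"
  by (simp add: grp.m_assoc generator_square)

lemma cox_length_le: "cox_length (val u) \<le> length u"
  unfolding cox_length_def by (rule Least_le) (auto simp: mem_val_iff)

lemma reduced_wordE:
  assumes "g \<in> carrier W" obtains u where "g = val u" "length u = cox_length g"
proof -
  obtain v where v: "g = val v" using assms by (rule in_carrierE)
  then have "v \<in> g" by (simp add: mem_val_iff)
  then have "\<exists>u\<in>g. length u = cox_length g"
    unfolding cox_length_def by - (rule LeastI_ex[of "\<lambda>n. \<exists>u\<in>g. length u = n"], blast)
  then obtain u where "u \<in> g" "length u = cox_length g" by blast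
  then show ?thesis using that[of u] v by (simp add: mem_val_iff)
qed

lemma reduced_words_val: "u \<in> reduced_words (val v) \<longleftrightarrow> val u = val v \<and> length u = cox_length (val u)"
  by (auto simp: reduced_words_def mem_val_iff)

lemma even_length_cong: "word_eq m u v \<Longrightarrow> even (length u) = even (length v)"
proof (induction rule: word_eq.induct)
  case (relator s t n u v)
  have "even (length (concat (replicate n [s, t])))" by (induction n) auto
  then show ?case by simp
qed auto

lemma even_cox_length: "even (cox_length (val u)) = even (length u)"
proof -
  obtain v where "val u = val v" "length v = cox_length (val u)"
    by (rule reduced_wordE[OF val_in_carrier])
  then show ?thesis using even_length_cong[of u v] by (simp add: val_eq_iff)
qed

lemma even_cox_length_mult:
  assumes "g \<in> carrier W" "h \<in> carrier W"
  shows "even (cox_length (g \<otimes>\<^bsub>W\<^esub> h)) = (even (cox_length g) = even (cox_length h))"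
proof -
  obtain u where u: "g = val u" using assms(1) by (rule in_carrierE)
  obtain v where v: "h = val v" using assms(2) by (rule in_carrierE)
  show ?thesis by (simp add: u v even_cox_length)
qed

lemma cox_length_mult_le:
  assumes "g \<in> carrier W" "h \<in> carrier W"
  shows "cox_length (g \<otimes>\<^bsub>W\<^esub> h) \<le> cox_length g + cox_length h"
proof -
  obtain u where u: "g = val u" "length u = cox_length g" by (rule reduced_wordE[OF assms(1)])
  obtain v where v: "h = val v" "length v = cox_length h" by (rule reduced_wordE[OF assms(2)])
  show ?thesis using cox_length_le[of "u @ v"] u v by simp
qed

lemma cox_length_inv:
  assumes "g \<in> carrier W" shows "cox_length (inv\<^bsub>W\<^esub> g) = cox_length g"
proof -
  have "cox_length (inv\<^bsub>W\<^esub> h) \<le> cox_length h" if h: "h \<in> carrier W" for h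
  proof -
    obtain u where "h = val u" "length u = cox_length h" by (rule reduced_wordE[OF h])
    then show ?thesis using cox_length_le[of "rev u"] by simp
  qed
  from this[of g] this[of "inv\<^bsub>W\<^esub> g"] show ?thesis using assms by simp
qed

lemma cox_length_one: "cox_length \<one>\<^bsub>W\<^esub> = 0"
  using cox_length_le[of "[]"] by (simp add: one_val)

lemma cox_length_generator:
  assumes "s \<in> generators m" shows "cox_length s = 1"
proof -
  obtain c where c: "s = val [c]" using assms by (rule generatorE)
  show ?thesis using cox_length_le[of "[c]"] even_cox_length[of "[c]"] c
    by (cases "cox_length s = 0") auto
qed

lemma cox_length_mult_generator:
  assumes "g \<in> carrier W" "s \<in> generators m"
  shows "cox_length (g \<otimes>\<^bsub>W\<^esub> s) = Suc (cox_length g) \<or> cox_length g = Suc (cox_length (g \<otimes>\<^bsub>W\<^esub> s))"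
proof -
  have "cox_length (g \<otimes>\<^bsub>W\<^esub> s) \<le> cox_length g + 1" "cox_length g \<le> cox_length (g \<otimes>\<^bsub>W\<^esub> s) + 1"
    using cox_length_mult_le[of g s] cox_length_mult_le[of "g \<otimes>\<^bsub>W\<^esub> s" s] assms
    by (simp_all add: cox_length_generator mult_generator_twice)
  moreover have "even (cox_length (g \<otimes>\<^bsub>W\<^esub> s)) \<noteq> even (cox_length g)"
    using assms by (simp add: even_cox_length_mult cox_length_generator)
  ultimately show ?thesis
    by (cases "cox_length g" "cox_length (g \<otimes>\<^bsub>W\<^esub> s)" rule: linorder_cases) auto
qed

lemma cox_length_0: "w \<in> carrier W \<Longrightarrow> cox_length w = 0 \<Longrightarrow> w = \<one>\<^bsub>W\<^esub>"
  by (rule reduced_wordE[of w]) (auto simp: one_val)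

lemma descent_exists:
  assumes "w \<in> carrier W" "cox_length w = Suc n"
  obtains s where "s \<in> generators m" "cox_length (w \<otimes>\<^bsub>W\<^esub> s) = n"
proof -
  obtain u where u: "w = val u" "length u = Suc n" using reduced_wordE[OF assms(1)] assms(2) by metis
  then obtain v c where v: "u = v @ [c]" by (cases u rule: rev_cases) auto
  have s: "val [c] \<in> generators m" by (simp add: generators_def)
  have "w \<otimes>\<^bsub>W\<^esub> val [c] = val v"
    using mult_generator_twice[OF _ s, of "val v"] by (simp add: u(1) v)
  then have "cox_length (w \<otimes>\<^bsub>W\<^esub> val [c]) \<le> n" using cox_length_le[of v] u(2) v by simp
  then show ?thesis using that[OF s] cox_length_mult_generator[OF assms(1) s] assms(2) by auto
qed

section \<open>Reflections and the strong exchange property\<close>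

definition conjugate :: "'s list set \<Rightarrow> 's list set \<Rightarrow> 's list set" where
  "conjugate g r = g \<otimes>\<^bsub>W\<^esub> r \<otimes>\<^bsub>W\<^esub> inv\<^bsub>W\<^esub> g"

lemma conjugate_closed [simp]: "g \<in> carrier W \<Longrightarrow> r \<in> carrier W \<Longrightarrow> conjugate g r \<in> carrier W"
  by (simp add: conjugate_def)

lemma conjugate_conjugate:
  "g \<in> carrier W \<Longrightarrow> h \<in> carrier W \<Longrightarrow> r \<in> carrier W \<Longrightarrow> conjugate g (conjugate h r) = conjugate (g \<otimes>\<^bsub>W\<^esub> h) r"
  by (simp add: conjugate_def grp.m_assoc grp.inv_mult_group)

lemma conjugate_one [simp]: "r \<in> carrier W \<Longrightarrow> conjugate \<one>\<^bsub>W\<^esub> r = r"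
  by (simp add: conjugate_def)

lemma conjugate_val: "conjugate (val u) (val v) = val (u @ v @ rev u)"
  by (simp add: conjugate_def)

lemma inj_on_conjugate:
  assumes "g \<in> carrier W" shows "inj_on (conjugate g) (carrier W)"
proof (rule inj_on_inverseI)
  show "conjugate (inv\<^bsub>W\<^esub> g) (conjugate g r) = r" if "r \<in> carrier W" for r
    using assms that by (simp add: conjugate_conjugate)
qed

lemma conjugate_Nil [simp]: "r \<in> carrier W \<Longrightarrow> conjugate (val []) r = r"
  by (simp flip: one_val)

text \<open>
  To the letter \<open>c\<close> in a word \<open>a @ [c] @ b\<close> belongs the reflection \<open>a c a\<inverse>\<close>; multiplying by it on the left
  deletes that letter. The list of these reflections depends on the word, but the parity with which a
  reflection occurs in it will turn out to depend on the value of the word only.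
\<close>
primrec refl_list :: "'s list \<Rightarrow> 's list set list" where
  "refl_list [] = []"
| "refl_list (c # u) = val [c] # map (conjugate (val [c])) (refl_list u)"

lemma refl_list_in_carrier: "set (refl_list u) \<subseteq> carrier W"
  by (induction u) auto

lemma refl_list_append: "refl_list (u @ v) = refl_list u @ map (conjugate (val u)) (refl_list v)"
proof (induction u)
  case Nil
  show ?case using refl_list_in_carrier[of v] by (simp add: map_idI subset_iff)
next
  case (Cons c u)
  show ?case using refl_list_in_carrier[of v] by (auto simp: Cons conjugate_conjugate)
qed

lemma refl_list_relator:
  "refl_list (concat (replicate n [s, t]))
     = map (\<lambda>i. val (concat (replicate i [s, t]) @ [s])) [0..<2 * n]"
proof (induction n)
  case (Suc n)
  let ?a = "\<lambda>i. concat (replicate i [s, t])"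
  have shift: "val (s # t # ?a i @ [s, t, s]) = val (?a (Suc (Suc i)) @ [s])" for i
  proof -
    have "?a i @ [s, t, s] = [s, t] @ ?a i @ [s]" by (induction i) auto
    then show ?thesis by (subst \<open>?a i @ [s, t, s] = _\<close>) simp
  qed
  have "[0..<2 * Suc n] = 0 # 1 # map (\<lambda>i. Suc (Suc i)) [0..<2 * n]"
    by (simp add: upt_conv_Cons map_Suc_upt flip: map_map[unfolded comp_def])
  then show ?case
    using shift by (simp add: Suc conjugate_val del: upt_Suc)
qed simp

text \<open>
  The \<open>i\<close>-th reflection of the relator is \<open>(s t)\<^sup>i s\<close>, which has period \<open>n\<close> in \<open>i\<close>, so the list of \<open>2n\<close>
  reflections is a list of length \<open>n\<close> repeated twice. The map \<open>f\<close> allows for conjugation by the word to the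
  left of the relator.
\<close>

lemma even_count_relator:
  assumes "m s t = enat n"
  shows "even (count_list (map f (refl_list (concat (replicate n [s, t])))) r)"
proof -
  let ?g = "\<lambda>i. val (concat (replicate i [s, t]) @ [s])"
  have period: "?g (i + n) = ?g i" for i
  proof -
    have "val (concat (replicate n [s, t]) @ concat (replicate i [s, t]) @ [s]) = ?g i"
      using word_eq.relator[of m s t n "[]"] assms by (simp add: val_eq_iff)
    then show ?thesis by (simp add: replicate_add add.commute[of i n])
  qed
  have "[0..<2 * n] = [0..<n] @ map (\<lambda>i. i + n) [0..<n]"
    using upt_add_eq_append[of 0 n n] by (simp add: mult_2 map_add_upt)
  then have "refl_list (concat (replicate n [s, t])) = map ?g [0..<n] @ map ?g [0..<n]"
    by (simp add: refl_list_relator period del: append_assoc)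
  then show ?thesis by simp
qed

text \<open>
  An inserted relator contributes each reflection an even number of times, and its value is trivial, so the
  reflections of the later letters stay the same. The parity is therefore a function on the group.
\<close>

lemma even_count_cong:
  "word_eq m u v \<Longrightarrow> even (count_list (refl_list u) r) = even (count_list (refl_list v) r)"
proof (induction rule: word_eq.induct)
  case (relator s t n u v)
  let ?R = "concat (replicate n [s, t])"
  have "val (u @ ?R) = val u"
    using word_eq.relator[of m s t n u "[]"] relator by (simp add: val_eq_iff)
  then have eq: "refl_list (u @ ?R @ v) = refl_list u @ map (conjugate (val u)) (refl_list ?R)
      @ map (conjugate (val u)) (refl_list v)"
    using refl_list_append[of "u @ ?R" v] by (simp add: refl_list_append)
  show ?case
    unfolding eq unfolding refl_list_append count_list_append even_add
    using even_count_relator[OF relator, of "conjugate (val u)" r] by blast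
qed simp_all

lemma count_map_conjugate:
  assumes "g \<in> carrier W" "r \<in> carrier W"
  shows "count_list (map (conjugate g) (refl_list u)) (conjugate g r) = count_list (refl_list u) r"
proof -
  have "count_list (map (conjugate g) xs) (conjugate g r) = count_list xs r" if "set xs \<subseteq> carrier W" for xs
    using that by (induction xs) (auto simp: inj_on_eq_iff[OF inj_on_conjugate[OF assms(1)]] assms(2))
  then show ?thesis using refl_list_in_carrier by blast
qed

lemma refl_list_rev: "refl_list (rev u) = rev (map (conjugate (val (rev u))) (refl_list u))"
proof (induction u)
  case (Cons c u)
  have "val [c, c, c] = val [c]"
    using val_mult[of "[c, c]" "[c]"] by (simp only: val_square) simp
  then have self: "conjugate (val [c]) (val [c]) = val [c]" by (simp add: conjugate_val)
  have split: "conjugate (val (rev u @ [c])) r = conjugate (val (rev u)) (conjugate (val [c]) r)"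
    if "r \<in> carrier W" for r
    using that by (simp add: conjugate_conjugate)
  have twice: "conjugate (val [c]) (conjugate (val [c]) r) = r" if "r \<in> carrier W" for r
  proof -
    have "conjugate (val [c]) (conjugate (val [c]) r) = conjugate (val [c, c]) r"
      using that by (simp add: conjugate_conjugate)
    then show ?thesis using that by (simp only: val_square conjugate_Nil)
  qed
  show ?case
    using refl_list_in_carrier[of u]
    by (simp add: refl_list_append Cons self split twice subset_iff)
qed simp

text \<open>
  The word is a palindrome, and conjugation by its value \<open>r\<close> maps the reflections of its first half to those
  of its second half while fixing \<open>r\<close>. So \<open>r\<close> occurs equally often in both halves, and once more in the
  middle.
\<close>

lemma odd_count_reflection:
  assumes "val (u @ [c] @ rev u) = r"
  shows "odd (count_list (refl_list (u @ [c] @ rev u)) r)"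
proof -
  have r: "r \<in> carrier W" "conjugate (val u) (val [c]) = r" using assms by (auto simp: conjugate_val)
  have "conjugate (val (u @ [c])) (conjugate (val (rev u)) x) = conjugate r x" if "x \<in> carrier W" for x
    using that assms by (simp add: conjugate_conjugate)
  then have "map (conjugate (val (u @ [c]))) (refl_list (rev u)) = rev (map (conjugate r) (refl_list u))"
    using refl_list_in_carrier[of u] by (simp add: refl_list_rev rev_map subset_iff)
  moreover have "refl_list (u @ [c]) = refl_list u @ [r]" by (simp add: refl_list_append r(2))
  ultimately have "refl_list (u @ [c] @ rev u) = refl_list u @ [r] @ rev (map (conjugate r) (refl_list u))"
    using refl_list_append[of "u @ [c]" "rev u"] by simp
  moreover have "conjugate r r = r" using r(1) by (simp add: conjugate_def grp.m_assoc)
  then have "count_list (map (conjugate r) (refl_list u)) r = count_list (refl_list u) r"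
    using count_map_conjugate[OF r(1) r(1)] by simp
  ultimately show ?thesis by (simp add: count_list_rev)
qed

lemma reflectionE:
  assumes "r \<in> reflections m"
  obtains u c where "r = val (u @ [c] @ rev u)"
proof -
  obtain g s where gs: "r = g \<otimes>\<^bsub>W\<^esub> s \<otimes>\<^bsub>W\<^esub> inv\<^bsub>W\<^esub> g" "g \<in> carrier W" "s \<in> generators m"
    using assms unfolding reflections_def by blast
  obtain u where "g = val u" using gs(2) by (rule in_carrierE)
  moreover obtain c where "s = val [c]" using gs(3) by (rule generatorE)
  ultimately show ?thesis using that gs(1) by simp
qed

lemma reflection_in_carrier [simp]: "r \<in> reflections m \<Longrightarrow> r \<in> carrier W"
  by (erule reflectionE) simp

lemma reflection_square: "r \<in> reflections m \<Longrightarrow> r \<otimes>\<^bsub>W\<^esub> r = \<one>\<^bsub>W\<^esub>"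
proof (erule reflectionE)
  fix u c assume r: "r = val (u @ [c] @ rev u)"
  then have "inv\<^bsub>W\<^esub> r = r" by simp
  then show ?thesis using grp.r_inv[of r] r val_in_carrier by metis
qed

lemma odd_cox_length_reflection: "r \<in> reflections m \<Longrightarrow> odd (cox_length r)"
  by (erule reflectionE) (simp add: even_cox_length)

lemma delete_letter:
  "r \<in> set (refl_list u) \<Longrightarrow> \<exists>a c b. u = a @ [c] @ b \<and> r \<otimes>\<^bsub>W\<^esub> val u = val (a @ b)"
proof (induction u arbitrary: r)
  case (Cons c u)
  show ?case
  proof (cases "r = val [c]")
    case True
    have "r \<otimes>\<^bsub>W\<^esub> val (c # u) = val [c, c] \<otimes>\<^bsub>W\<^esub> val u" using True by simp
    then have "r \<otimes>\<^bsub>W\<^esub> val (c # u) = val ([] @ u)" by (simp only: val_square) simp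
    then show ?thesis by (metis append_Cons append_Nil)
  next
    case False
    then obtain r' where r': "r' \<in> set (refl_list u)" "r = conjugate (val [c]) r'"
      using Cons.prems by auto
    then obtain a d b where ab: "u = a @ [d] @ b" "r' \<otimes>\<^bsub>W\<^esub> val u = val (a @ b)"
      using Cons.IH by blast
    have "r' \<in> carrier W" using r'(1) refl_list_in_carrier by blast
    then obtain v where v: "r' = val v" by (rule in_carrierE)
    have "r \<otimes>\<^bsub>W\<^esub> val (c # u) = val (c # v) \<otimes>\<^bsub>W\<^esub> val [c, c] \<otimes>\<^bsub>W\<^esub> val u"
      by (simp add: r'(2) v conjugate_val)
    also have "\<dots> = val [c] \<otimes>\<^bsub>W\<^esub> (r' \<otimes>\<^bsub>W\<^esub> val u)"
      by (simp only: val_square) (simp add: v)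
    also have "\<dots> = val ((c # a) @ b)" by (simp add: ab(2))
    finally show ?thesis using ab(1) by (metis append_Cons)
  qed
qed simp

text \<open>
  Pass to the reflection \<open>r' = u r u\<inverse>\<close>, which acts on the left. If it did not occur in the list of \<open>u\<close>, then
  it would occur an odd number of times in a list for \<open>r' u\<close>, because it occurs an odd number of times in
  the list of a word for itself. A letter could then be deleted from a reduced word for \<open>r' u\<close> to yield \<open>u\<close>,
  so \<open>u\<close> would be shorter than \<open>r' u = u r\<close>, contrary to the assumption.
\<close>

theorem strong_exchange:
  assumes r: "r \<in> reflections m" and less: "cox_length (val u \<otimes>\<^bsub>W\<^esub> r) < cox_length (val u)"
  shows "\<exists>a c b. u = a @ [c] @ b \<and> val u \<otimes>\<^bsub>W\<^esub> r = val (a @ b)"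
proof -
  define r' where "r' = conjugate (val u) r"
  obtain v c where v: "r = val (v @ [c] @ rev v)" using r by (rule reflectionE)
  define p where "p = (u @ v) @ [c] @ rev (u @ v)"
  have r': "r' = val p" by (simp add: r'_def v p_def conjugate_val)
  have left: "r' \<otimes>\<^bsub>W\<^esub> val u = val u \<otimes>\<^bsub>W\<^esub> r"
    using r by (simp add: r'_def conjugate_def grp.m_assoc del: inv_val)
  have "r' \<in> set (refl_list u)"
  proof (rule ccontr)
    assume "r' \<notin> set (refl_list u)"
    then have "count_list (refl_list u) r' = 0" by (simp add: count_list_0_iff)
    moreover have "conjugate r' r' = r'" by (simp add: r' conjugate_def grp.m_assoc del: inv_val val_mult)
    moreover have "odd (count_list (refl_list p) r')"
      unfolding p_def by (rule odd_count_reflection) (simp add: r' p_def)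
    ultimately have "odd (count_list (refl_list (p @ u)) r')"
      using count_map_conjugate[of r' r' u] by (simp add: refl_list_append r')
    moreover obtain z where z: "val (p @ u) = val z" "length z = cox_length (val (p @ u))"
      by (rule reduced_wordE[OF val_in_carrier])
    ultimately have "odd (count_list (refl_list z) r')"
      using even_count_cong val_eq_iff by blast
    then have "r' \<in> set (refl_list z)" by (metis count_list_0_iff even_zero)
    then obtain a d b where ab: "z = a @ [d] @ b" "r' \<otimes>\<^bsub>W\<^esub> val z = val (a @ b)"
      using delete_letter by blast
    have "r' \<otimes>\<^bsub>W\<^esub> val z = val u \<otimes>\<^bsub>W\<^esub> r \<otimes>\<^bsub>W\<^esub> r"
    proof -
      have "r' \<otimes>\<^bsub>W\<^esub> val z = conjugate (val u) r \<otimes>\<^bsub>W\<^esub> (val u \<otimes>\<^bsub>W\<^esub> r)"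
        using z(1) left by (simp add: r' flip: r'_def)
      moreover have "inv\<^bsub>W\<^esub> (val u) \<otimes>\<^bsub>W\<^esub> (val u \<otimes>\<^bsub>W\<^esub> r) = r"
        using r by (simp del: inv_val flip: grp.m_assoc)
      ultimately show ?thesis using r by (simp add: conjugate_def grp.m_assoc del: inv_val)
    qed
    then have "r' \<otimes>\<^bsub>W\<^esub> val z = val u"
      using r by (simp add: grp.m_assoc reflection_square)
    then have "cox_length (val u) < length z"
      using cox_length_le[of "a @ b"] ab by simp
    then show False using z less left by (simp add: r')
  qed
  then show ?thesis using delete_letter left by metis
qed

section \<open>Bruhat order\<close>

lemma bruhat_le_refl [simp]: "bruhat_le m x x"
  by (simp add: bruhat_le_def)

lemma bruhat_le_trans: "bruhat_le m x y \<Longrightarrow> bruhat_le m y z \<Longrightarrow> bruhat_le m x z"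
  unfolding bruhat_le_def by (rule rtrancl_trans)

lemma bruhat_le_reflection:
  assumes "x \<in> carrier W" "r \<in> reflections m" "cox_length x < cox_length (x \<otimes>\<^bsub>W\<^esub> r)"
  shows "bruhat_le m x (x \<otimes>\<^bsub>W\<^esub> r)"
  unfolding bruhat_le_def using assms by (intro r_into_rtrancl) blast

lemma bruhat_le_induct [consumes 1, case_names refl step]:
  assumes "bruhat_le m x w"
    and "P w"
    and "\<And>u r. u \<in> carrier W \<Longrightarrow> r \<in> reflections m \<Longrightarrow> cox_length u < cox_length (u \<otimes>\<^bsub>W\<^esub> r) \<Longrightarrow>
      bruhat_le m (u \<otimes>\<^bsub>W\<^esub> r) w \<Longrightarrow> P (u \<otimes>\<^bsub>W\<^esub> r) \<Longrightarrow> P u"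
  shows "P x"
  using assms(1) unfolding bruhat_le_def
  by (induction rule: converse_rtrancl_induct) (use assms in \<open>auto simp: bruhat_le_def\<close>)

lemma bruhat_less_cox_length:
  assumes "bruhat_less m x w" shows "cox_length x < cox_length w"
proof -
  have "bruhat_le m x w" "x \<noteq> w" using assms by (auto simp: bruhat_less_def)
  then have "x = w \<or> cox_length x < cox_length w"
  proof (induction rule: bruhat_le_induct)
    case (step u r)
    then show ?case by (metis less_trans)
  qed simp
  then show ?thesis using \<open>x \<noteq> w\<close> by blast
qed

lemma generator_reflection: "s \<in> generators m \<Longrightarrow> s \<in> reflections m"
  unfolding reflections_def by (rule CollectI, rule exI[of _ "\<one>\<^bsub>W\<^esub>"], rule exI[of _ s]) simp

lemma conjugate_reflection:
  assumes "g \<in> carrier W" "r \<in> reflections m" shows "conjugate g r \<in> reflections m"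
proof -
  obtain h s where hs: "r = conjugate h s" "h \<in> carrier W" "s \<in> generators m"
    using assms(2) unfolding reflections_def conjugate_def by blast
  then have "conjugate g r = conjugate (g \<otimes>\<^bsub>W\<^esub> h) s" "g \<otimes>\<^bsub>W\<^esub> h \<in> carrier W"
    using assms(1) by (simp_all add: conjugate_conjugate)
  then show ?thesis using hs(3) unfolding reflections_def conjugate_def by blast
qed

lemma bruhat_less_mult_generator:
  assumes "g \<in> carrier W" "s \<in> generators m"
  shows "bruhat_less m g (g \<otimes>\<^bsub>W\<^esub> s) \<longleftrightarrow> cox_length g < cox_length (g \<otimes>\<^bsub>W\<^esub> s)"
    and "bruhat_less m (g \<otimes>\<^bsub>W\<^esub> s) g \<longleftrightarrow> cox_length (g \<otimes>\<^bsub>W\<^esub> s) < cox_length g"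
proof -
  have "bruhat_le m h (h \<otimes>\<^bsub>W\<^esub> s)" if "h \<in> carrier W" "cox_length h < cox_length (h \<otimes>\<^bsub>W\<^esub> s)" for h
    using that assms(2) by (intro bruhat_le_reflection generator_reflection)
  from this[of g] this[of "g \<otimes>\<^bsub>W\<^esub> s"]
  show "bruhat_less m g (g \<otimes>\<^bsub>W\<^esub> s) \<longleftrightarrow> cox_length g < cox_length (g \<otimes>\<^bsub>W\<^esub> s)"
    "bruhat_less m (g \<otimes>\<^bsub>W\<^esub> s) g \<longleftrightarrow> cox_length (g \<otimes>\<^bsub>W\<^esub> s) < cox_length g"
    using assms
    by (simp_all add: mult_generator_twice) (metis bruhat_less_def bruhat_less_cox_length less_irrefl)+
qed

text \<open>
  Either \<open>xs\<close> and \<open>xrs\<close>, which differ by the reflection \<open>s r s\<close>, are ordered like \<open>x\<close> and \<open>xr\<close>, or \<open>xs\<close> lies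
  below \<open>x\<close>, or \<open>xrs\<close> is shorter than \<open>xs\<close> and \<open>xs\<close> is longer than \<open>x\<close>. In the last case strong exchange
  deletes a letter from a reduced word of \<open>xs\<close> that ends in \<open>s\<close>. If that is the final \<open>s\<close>, then \<open>xr = xs\<close>;
  any other letter would leave a word that shows \<open>xr\<close> to be shorter than \<open>x\<close>.
\<close>

lemma bruhat_lifting_step:
  assumes x: "x \<in> carrier W" and r: "r \<in> reflections m" and s: "s \<in> generators m"
    and less: "cox_length x < cox_length (x \<otimes>\<^bsub>W\<^esub> r)"
  shows "bruhat_le m (x \<otimes>\<^bsub>W\<^esub> s) (x \<otimes>\<^bsub>W\<^esub> r) \<or> bruhat_le m (x \<otimes>\<^bsub>W\<^esub> s) (x \<otimes>\<^bsub>W\<^esub> r \<otimes>\<^bsub>W\<^esub> s)"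
proof -
  let ?xs = "x \<otimes>\<^bsub>W\<^esub> s" and ?y = "x \<otimes>\<^bsub>W\<^esub> r" and ?ys = "x \<otimes>\<^bsub>W\<^esub> r \<otimes>\<^bsub>W\<^esub> s"
  define t where "t = conjugate s r"
  have t: "t \<in> reflections m" using r s by (simp add: t_def conjugate_reflection)
  have xst: "?xs \<otimes>\<^bsub>W\<^esub> t = ?ys"
  proof -
    have "s \<otimes>\<^bsub>W\<^esub> (s \<otimes>\<^bsub>W\<^esub> (r \<otimes>\<^bsub>W\<^esub> s)) = r \<otimes>\<^bsub>W\<^esub> s"
      using r s by (simp add: generator_square flip: grp.m_assoc)
    then show ?thesis using x r s by (simp add: t_def conjugate_def inv_generator grp.m_assoc)
  qed
  \<comment> \<open>Multiplication by a reflection changes the parity of the length, so equal lengths are excluded.\<close>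
  consider "cox_length ?xs < cox_length ?ys" | "cox_length ?xs < cox_length x"
    | "cox_length ?ys < cox_length ?xs" "cox_length ?xs = Suc (cox_length x)"
  proof -
    have "even (cox_length ?ys) \<noteq> even (cox_length ?xs)"
      using even_cox_length_mult[of ?xs t] x s t by (simp add: xst odd_cox_length_reflection)
    then have "cox_length ?ys \<noteq> cox_length ?xs" by metis
    then show ?thesis using that cox_length_mult_generator[OF x s] by linarith
  qed
  then show ?thesis
  proof cases
    case 1
    then have "bruhat_le m ?xs ?ys"
      using bruhat_le_reflection[of ?xs t] x s t xst by simp
    then show ?thesis ..
  next
    case 2
    then have "bruhat_le m ?xs x"
      using bruhat_less_mult_generator(2)[OF x s] by (simp add: bruhat_less_def)
    then have "bruhat_le m ?xs ?y"
      using bruhat_le_trans bruhat_le_reflection[OF x r less] by blast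
    then show ?thesis ..
  next
    case 3
    obtain u where u: "x = val u" "length u = cox_length x" by (rule reduced_wordE[OF x])
    obtain c where c: "s = val [c]" using s by (rule generatorE)
    obtain a d b where ab: "u @ [c] = a @ [d] @ b" "?ys = val (a @ b)"
      using strong_exchange[OF t, of "u @ [c]"] 3 xst by (auto simp: u(1) c)
    have y: "?y = ?ys \<otimes>\<^bsub>W\<^esub> s" using x r s by (simp add: mult_generator_twice)
    show ?thesis
    proof (cases b rule: rev_cases)
      case Nil
      then have "?ys = x" using ab u(1) by simp
      then show ?thesis using y by simp
    next
      case (snoc b' e)
      then have "u = a @ [d] @ b'" "?ys = val (a @ b' @ [c])" using ab by simp_all
      moreover have "val (a @ b' @ [c]) \<otimes>\<^bsub>W\<^esub> s = val (a @ b') \<otimes>\<^bsub>W\<^esub> s \<otimes>\<^bsub>W\<^esub> s" by (simp add: c)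
      ultimately have "?y = val (a @ b')" using y s by (simp only: mult_generator_twice val_in_carrier)
      then have "cox_length ?y \<le> length (a @ b')" by (metis cox_length_le)
      then show ?thesis using \<open>u = a @ [d] @ b'\<close> u(2) less by simp
    qed
  qed
qed

lemma bruhat_lifting:
  assumes "bruhat_le m x w" "x \<in> carrier W" and s: "s \<in> generators m"
  shows "bruhat_le m (x \<otimes>\<^bsub>W\<^esub> s) w \<or> bruhat_le m (x \<otimes>\<^bsub>W\<^esub> s) (w \<otimes>\<^bsub>W\<^esub> s)"
  using assms(1)
proof (induction rule: bruhat_le_induct)
  case (step u r)
  show ?case
    using bruhat_lifting_step[OF step(1,2) s step(3)] step(4,5) bruhat_le_trans by blast
qed simp

text \<open>
  A weak form of the subword property: by strong exchange, each step down a Bruhat chain deletes a letter.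
\<close>

lemma bruhat_le_subword:
  assumes "bruhat_le m x (val u)"
  shows "\<exists>v. set v \<subseteq> set u \<and> length v \<le> length u \<and> x = val v"
  using assms
proof (induction rule: bruhat_le_induct)
  case (step x r)
  then obtain v where v: "set v \<subseteq> set u" "length v \<le> length u" "x \<otimes>\<^bsub>W\<^esub> r = val v" by blast
  have "x = x \<otimes>\<^bsub>W\<^esub> r \<otimes>\<^bsub>W\<^esub> r"
    using step(1,2) by (simp add: grp.m_assoc reflection_square)
  then have "cox_length (val v \<otimes>\<^bsub>W\<^esub> r) < cox_length (val v)" "x = val v \<otimes>\<^bsub>W\<^esub> r"
    using step(3) v(3) by simp_all
  then obtain a c b where "v = a @ [c] @ b" "x = val (a @ b)"
    using strong_exchange[OF step(2), of v] by metis
  then show ?case using v by (intro exI[of _ "a @ b"]) auto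
qed auto

lemma finite_bruhat_interval:
  assumes "w \<in> carrier W" shows "finite {x. bruhat_le m x w}"
proof -
  obtain u where u: "w = val u" using assms by (rule in_carrierE)
  have "{x. bruhat_le m x w} \<subseteq> val ` {v. set v \<subseteq> set u \<and> length v \<le> length u}"
    using bruhat_le_subword unfolding u by blast
  then show ?thesis
    by (rule finite_subset) (simp add: finite_lists_length_le)
qed

section \<open>Fully commutative elements\<close>

lemma fully_commutative_in_carrier [simp]: "w \<in> fully_commutative m \<Longrightarrow> w \<in> carrier W"
  by (simp add: fully_commutative_def)

text \<open>
  Deleting the last occurrence of \<open>c\<close> undoes appending \<open>c\<close>, and it is compatible with commutations in the
  whole word, even when they move that occurrence away from the end.
\<close>
definition remove_last :: "'s \<Rightarrow> 's list \<Rightarrow> 's list" where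
  "remove_last c u = rev (remove1 c (rev u))"

lemma remove_last_snoc: "remove_last c (u @ [c]) = u"
  by (simp add: remove_last_def)

text \<open>
  If the deleted letter is one of the two that are exchanged, both words become equal. Otherwise the
  deletion happens on one side of them and leaves the commutation intact.
\<close>

lemma remove_last_commutation_step:
  assumes "(u, v) \<in> commutation_step m"
  shows "(remove_last c u, remove_last c v) \<in> (commutation_step m)\<^sup>*"
proof -
  obtain a b s t where uv: "u = a @ [s, t] @ b" "v = a @ [t, s] @ b" "m s t = 2"
    using assms unfolding commutation_step_def by blast
  have step: "(a' @ [s, t] @ b', a' @ [t, s] @ b') \<in> commutation_step m" for a' b'
    using uv(3) unfolding commutation_step_def by blast
  show ?thesis
    using step[of a "remove_last c b"] step[of "remove_last c a" b]
    by (auto simp: uv(1,2) remove_last_def remove1_append)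
qed

text \<open>
  Reduced words of \<open>ws\<close> become reduced words of \<open>w\<close> when the letter \<open>s\<close> is appended. The commutations that
  connect the latter project to commutations that connect the former.
\<close>

lemma fully_commutative_mult_generator:
  assumes w: "w \<in> fully_commutative m" and s: "s \<in> generators m"
    and less: "cox_length (w \<otimes>\<^bsub>W\<^esub> s) < cox_length w"
  shows "w \<otimes>\<^bsub>W\<^esub> s \<in> fully_commutative m"
proof -
  obtain c where c: "s = val [c]" using s by (rule generatorE)
  have w': "w \<in> carrier W" using w by simp
  have snoc: "u @ [c] \<in> reduced_words w" if u: "u \<in> reduced_words (w \<otimes>\<^bsub>W\<^esub> s)" for u
  proof -
    obtain v where v: "w = val v" by (rule in_carrierE[OF w'])
    have "val u = w \<otimes>\<^bsub>W\<^esub> s" "length u = cox_length (w \<otimes>\<^bsub>W\<^esub> s)"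
      using u by (auto simp: v c reduced_words_val)
    then have "val (u @ [c]) = w"
      using mult_generator_twice[OF w' s] by (simp add: c flip: val_mult)
    moreover have "length (u @ [c]) = cox_length w"
      using cox_length_mult_generator[OF w' s] less \<open>length u = _\<close> by simp
    ultimately show ?thesis by (simp add: v reduced_words_val)
  qed
  have "(remove_last c u, remove_last c v) \<in> (commutation_step m)\<^sup>*"
    if "(u, v) \<in> (commutation_step m)\<^sup>*" for u v
    using that by induction (auto intro: rtrancl_trans remove_last_commutation_step)
  then have "(u, v) \<in> (commutation_step m)\<^sup>*"
    if "u \<in> reduced_words (w \<otimes>\<^bsub>W\<^esub> s)" "v \<in> reduced_words (w \<otimes>\<^bsub>W\<^esub> s)" for u v
    using w snoc[OF that(1)] snoc[OF that(2)] remove_last_snoc unfolding fully_commutative_def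
    by (metis (no_types, lifting) mem_Collect_eq)
  then show ?thesis
    using w' s unfolding fully_commutative_def by simp
qed

end

section \<open>Algebras over Laurent polynomials\<close>

lemma laurent_ring_simps [simp]:
  "carrier laurent_ring = UNIV" "a \<otimes>\<^bsub>laurent_ring\<^esub> b = a * b" "\<one>\<^bsub>laurent_ring\<^esub> = 1"
  "\<zero>\<^bsub>laurent_ring\<^esub> = 0" "a \<oplus>\<^bsub>laurent_ring\<^esub> b = a + b"
  by (simp_all add: laurent_ring_def)

lemma of_poly_pCons [simp]: "of_poly (pCons c p) = of_int c + q_pow 1 * of_poly p"
  by (simp add: of_poly_def map_poly_pCons)

lemma of_poly_0 [simp]: "of_poly 0 = 0"
  by (simp add: of_poly_def)

lemma of_poly_1 [simp]: "of_poly 1 = 1"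
  by (simp add: of_poly_def)

lemma of_poly_add [simp]: "of_poly (p + r) = of_poly p + of_poly r"
  by (induction p r rule: poly_induct2) (simp_all add: algebra_simps)

lemma of_poly_smult [simp]: "of_poly (Polynomial.smult c p) = of_int c * of_poly p"
  by (induction p) (simp_all add: algebra_simps)

lemma of_poly_mult [simp]: "of_poly (p * r) = of_poly p * of_poly r"
  by (induction p) (simp_all add: algebra_simps)

lemma of_poly_uminus [simp]: "of_poly (- p) = - of_poly p"
  using of_poly_add[of p "- p"] by (simp add: eq_neg_iff_add_eq_0 add.commute)

lemma of_poly_diff [simp]: "of_poly (p - r) = of_poly p - of_poly r"
  using of_poly_add[of p "- r"] by simp

lemma q_pow_add: "q_pow (i + j) = q_pow i * q_pow j"
  by (simp add: q_pow_def mult_single distrib_left)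

lemma q_pow_0 [simp]: "q_pow 0 = 1"
  by (simp add: q_pow_def)

lemma q_pow_inverse: "q_pow (- i) * q_pow i = 1"
  by (simp flip: q_pow_add)

lemma (in monoid) inv_mult_Units:
  assumes "x \<in> Units G" "y \<in> Units G" shows "inv (x \<otimes> y) = inv y \<otimes> inv x"
proof (rule inv_unique'[symmetric])
  have "x \<otimes> (y \<otimes> inv y) \<otimes> inv x = \<one>" "inv y \<otimes> (inv x \<otimes> x) \<otimes> y = \<one>"
    using assms by (simp_all add: Units_closed)
  then show "x \<otimes> y \<otimes> (inv y \<otimes> inv x) = \<one>" "inv y \<otimes> inv x \<otimes> (x \<otimes> y) = \<one>"
    using assms by (simp_all only: m_assoc Units_closed Units_inv_closed m_closed)
qed (use assms in \<open>simp_all add: Units_closed\<close>)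

locale laurent_algebra =
  fixes A :: "(laurent, 'a) module" (structure)
  assumes associative_algebra: "associative_algebra A"
begin

sublocale module laurent_ring A
  using associative_algebra by (simp add: associative_algebra_def)

sublocale alg: ring A
  using associative_algebra by (simp add: associative_algebra_def)

lemma smult_mult:
  assumes "x \<in> carrier A" "y \<in> carrier A"
  shows "(a \<odot> x) \<otimes> y = a \<odot> (x \<otimes> y)" "x \<otimes> (a \<odot> y) = a \<odot> (x \<otimes> y)"
  using associative_algebra assms by (simp_all add: associative_algebra_def)

lemma smult_closed' [simp]: "x \<in> carrier A \<Longrightarrow> a \<odot> x \<in> carrier A"
  using smult_closed[of a x] by simp

lemma smult_rules:
  "x \<in> carrier A \<Longrightarrow> (a + b) \<odot> x = a \<odot> x \<oplus> b \<odot> x"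
  "x \<in> carrier A \<Longrightarrow> y \<in> carrier A \<Longrightarrow> a \<odot> (x \<oplus> y) = a \<odot> x \<oplus> a \<odot> y"
  "x \<in> carrier A \<Longrightarrow> a \<odot> (b \<odot> x) = (a * b) \<odot> x"
  "x \<in> carrier A \<Longrightarrow> 1 \<odot> x = x"
  "x \<in> carrier A \<Longrightarrow> 0 \<odot> x = \<zero>"
  using smult_l_distr[of a b x] smult_r_distr[of a x y] smult_assoc1[of a b x] smult_one[of x]
    smult_l_null[of x] by simp_all

text \<open>
  An ideal of the ring is a submodule, since scalars act through multiplication by \<open>a \<odot> \<one>\<close>.
\<close>

lemma ideal_smult_closed:
  assumes "ideal J A" "h \<in> J" shows "a \<odot> h \<in> J"
proof -
  interpret J: ideal J A by (rule assms)
  have h: "h \<in> carrier A" using assms(2) J.a_subset by blast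
  have "(a \<odot> \<one>) \<otimes> h \<in> J" using assms(2) by (intro J.I_l_closed) simp_all
  then show ?thesis using h by (simp add: smult_mult)
qed

text \<open>
  The union over the coset is a single coset, as \<open>J\<close> is stable under scalars.
\<close>

lemma coset_smult:
  assumes "ideal J A" "h \<in> carrier A"
  shows "(\<Union>k\<in>J +> h. J +> (a \<odot> k)) = J +> (a \<odot> h)"
proof -
  interpret J: ideal J A by (rule assms)
  have "J +> (a \<odot> k) = J +> (a \<odot> h)" if k: "k \<in> J +> h" for k
  proof -
    obtain j where j: "j \<in> J" "k = j \<oplus> h" using k by (auto simp: a_r_coset_def')
    have jA: "j \<in> carrier A" using j(1) J.a_subset by blast
    have "a \<odot> k = a \<odot> j \<oplus> a \<odot> h" using j jA assms(2) by (simp add: smult_rules)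
    then have "a \<odot> k \<in> J +> (a \<odot> h)"
      using ideal_smult_closed[OF assms(1) j(1)] by (auto simp: a_r_coset_def')
    then show ?thesis using J.a_repr_independence' assms(2) by simp
  qed
  moreover have "h \<in> J +> h" using J.a_rcos_self assms(2) by simp
  ultimately show ?thesis by blast
qed

end

lemma ring_transfer:
  assumes "ring R"
    and "carrier S = carrier R" "mult S = mult R" "one S = one R" "zero S = zero R" "add S = add R"
  shows "ring S"
proof -
  interpret R: ring R by (rule assms)
  show ?thesis
  proof (rule ringI)
    show "abelian_group S"
      by (rule abelian_groupI)
        (use R.a_assoc R.a_comm R.l_neg R.a_inv_closed in \<open>auto simp: assms(2-)\<close>)
    show "monoid S"
      by (rule monoidI) (auto simp: assms(2-) R.m_assoc)
  qed (simp_all add: assms(2-) R.l_distr R.r_distr)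
qed

definition (in laurent_algebra) quotient :: "'a set \<Rightarrow> (laurent, 'a set) module" where
  "quotient J = \<lparr>carrier = carrier (A Quot J), mult = mult (A Quot J), one = one (A Quot J),
     zero = zero (A Quot J), add = add (A Quot J), smult = (\<lambda>a C. \<Union>h\<in>C. J +> (a \<odot> h))\<rparr>"

lemma (in laurent_algebra) quotient_simps:
  assumes "ideal J A"
  shows "h \<in> carrier A \<Longrightarrow> J +> h \<in> carrier (quotient J)"
    and "h \<in> carrier A \<Longrightarrow> k \<in> carrier A \<Longrightarrow> (J +> h) \<otimes>\<^bsub>quotient J\<^esub> (J +> k) = J +> (h \<otimes> k)"
    and "h \<in> carrier A \<Longrightarrow> k \<in> carrier A \<Longrightarrow> (J +> h) \<oplus>\<^bsub>quotient J\<^esub> (J +> k) = J +> (h \<oplus> k)"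
    and "h \<in> carrier A \<Longrightarrow> a \<odot>\<^bsub>quotient J\<^esub> (J +> h) = J +> (a \<odot> h)"
    and "\<one>\<^bsub>quotient J\<^esub> = J +> \<one>"
proof -
  interpret J: ideal J A by (rule assms)
  show "h \<in> carrier A \<Longrightarrow> J +> h \<in> carrier (quotient J)"
    using a_rcosetsI[OF J.a_subset] by (simp add: quotient_def FactRing_def)
qed (use assms in \<open>simp_all add: quotient_def FactRing_def ideal.rcoset_mult_add ideal.a_rcos_sum
    coset_smult\<close>)

lemma (in laurent_algebra) associative_algebra_quotient:
  assumes "ideal J A" shows "associative_algebra (quotient J)"
proof -
  note simps = quotient_simps[OF assms]
  have ring: "ring (quotient J)"
    by (rule ring_transfer[OF ideal.quotient_is_ring[OF assms]]) (simp_all add: quotient_def)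
  have coset: "\<exists>h\<in>carrier A. C = J +> h" if "C \<in> carrier (quotient J)" for C
    using that by (auto simp: quotient_def FactRing_def A_RCOSETS_def')
  have "module laurent_ring (quotient J)"
  proof (rule moduleI)
    show "cring laurent_ring" by (rule R.is_cring)
    show "abelian_group (quotient J)" using ring by (rule ring.is_abelian_group)
  qed (auto dest!: coset simp: simps smult_rules)
  then show ?thesis
    using ring by (auto simp: associative_algebra_def simps smult_mult dest!: coset)
qed


section \<open>The Temperley-Lieb algebra\<close>

locale temperley_lieb = coxeter m for m :: "'s \<Rightarrow> 's \<Rightarrow> enat" +
  fixes H :: "(laurent, 'h) module" and T :: "'s list set \<Rightarrow> 'h"
  assumes hecke_algebra: "hecke_algebra m H T"
begin

sublocale hecke: laurent_algebra H
  using hecke_algebra by unfold_locales (simp add: hecke_algebra_def)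

abbreviation TL :: "(laurent, 'h set) module" where "TL \<equiv> TL_algebra m H T"
abbreviation t :: "'s list set \<Rightarrow> 'h set" where "t \<equiv> TL_elt m H T"

lemma T_closed [simp]: "w \<in> carrier W \<Longrightarrow> T w \<in> carrier H"
  using hecke_algebra by (auto simp: hecke_algebra_def linear_basis_def)

lemma ideal_TL_ideal: "ideal (TL_ideal m H T) H"
proof -
  have "finsum H T (generate W {s, s'}) \<in> carrier H" if "s \<in> generators m" "s' \<in> generators m" for s s'
  proof -
    have "generate W {s, s'} \<subseteq> carrier W" using that by (intro grp.generate_incl) simp
    then show ?thesis by (intro hecke.finsum_closed) auto
  qed
  then show ?thesis
    unfolding TL_ideal_def by (intro hecke.alg.genideal_ideal) blast
qed

lemma TL_eq_quotient: "TL = hecke.quotient (TL_ideal m H T)"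
  by (simp only: TL_algebra_def hecke.quotient_def Let_def)

sublocale TL: laurent_algebra TL
  by unfold_locales (simp add: TL_eq_quotient hecke.associative_algebra_quotient ideal_TL_ideal)

lemmas coset_simps = hecke.quotient_simps[OF ideal_TL_ideal, folded TL_eq_quotient]

lemma t_closed [simp]: "w \<in> carrier W \<Longrightarrow> t w \<in> carrier TL"
  by (simp add: TL_elt_def coset_simps)

lemma t_one: "t \<one>\<^bsub>W\<^esub> = \<one>\<^bsub>TL\<^esub>"
  using hecke_algebra by (simp add: TL_elt_def coset_simps hecke_algebra_def)

lemma t_mult_ascent:
  assumes "w \<in> carrier W" "s \<in> generators m" "cox_length w < cox_length (w \<otimes>\<^bsub>W\<^esub> s)"
  shows "t w \<otimes>\<^bsub>TL\<^esub> t s = t (w \<otimes>\<^bsub>W\<^esub> s)"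
  using assms hecke_algebra by (simp add: TL_elt_def coset_simps hecke_algebra_def Let_def)

lemma t_mult_descent:
  assumes "w \<in> carrier W" "s \<in> generators m" "cox_length (w \<otimes>\<^bsub>W\<^esub> s) < cox_length w"
  shows "t w \<otimes>\<^bsub>TL\<^esub> t s = q_pow 1 \<odot>\<^bsub>TL\<^esub> t (w \<otimes>\<^bsub>W\<^esub> s) \<oplus>\<^bsub>TL\<^esub> (q_pow 1 - 1) \<odot>\<^bsub>TL\<^esub> t w"
proof -
  have "T w \<otimes>\<^bsub>H\<^esub> T s = q_pow 1 \<odot>\<^bsub>H\<^esub> T (w \<otimes>\<^bsub>W\<^esub> s) \<oplus>\<^bsub>H\<^esub> (q_pow 1 - 1) \<odot>\<^bsub>H\<^esub> T w"
    using assms hecke_algebra by (simp add: hecke_algebra_def Let_def)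
  then show ?thesis using assms by (simp add: TL_elt_def coset_simps)
qed

text \<open>
  The defining relations only multiply by generators from the right. This lemma makes multiplication from the
  left available as well.
\<close>

lemma t_mult:
  assumes "g \<in> carrier W" "h \<in> carrier W" "cox_length (g \<otimes>\<^bsub>W\<^esub> h) = cox_length g + cox_length h"
  shows "t (g \<otimes>\<^bsub>W\<^esub> h) = t g \<otimes>\<^bsub>TL\<^esub> t h"
  using assms(2,3)
proof (induction "cox_length h" arbitrary: h)
  case 0
  then have "h = \<one>\<^bsub>W\<^esub>" by (simp add: cox_length_0)
  then show ?case using assms(1) by (simp add: t_one)
next
  case (Suc n)
  obtain s where s: "s \<in> generators m" "cox_length (h \<otimes>\<^bsub>W\<^esub> s) = n"
    using descent_exists[OF Suc.prems(1)] Suc.hyps(2) by metis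
  define k where "k = h \<otimes>\<^bsub>W\<^esub> s"
  have k: "k \<in> carrier W" "k \<otimes>\<^bsub>W\<^esub> s = h" "cox_length k = n"
    using s Suc.prems(1) by (simp_all add: k_def mult_generator_twice)
  have gh: "g \<otimes>\<^bsub>W\<^esub> h = (g \<otimes>\<^bsub>W\<^esub> k) \<otimes>\<^bsub>W\<^esub> s"
    using assms(1) k s(1) by (simp add: grp.m_assoc)
  have len: "cox_length (g \<otimes>\<^bsub>W\<^esub> k) = cox_length g + n"
    using cox_length_mult_le[of g k] cox_length_mult_generator[of "g \<otimes>\<^bsub>W\<^esub> k" s] assms(1) k s(1)
      Suc.prems(2) Suc.hyps(2) gh by auto
  have "t (g \<otimes>\<^bsub>W\<^esub> h) = t (g \<otimes>\<^bsub>W\<^esub> k) \<otimes>\<^bsub>TL\<^esub> t s"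
    using assms(1) k s(1) len Suc.prems(2) Suc.hyps(2) by (simp add: gh t_mult_ascent)
  also have "t (g \<otimes>\<^bsub>W\<^esub> k) = t g \<otimes>\<^bsub>TL\<^esub> t k"
    using Suc.hyps(1)[of k] k len by simp
  also have "t g \<otimes>\<^bsub>TL\<^esub> t k \<otimes>\<^bsub>TL\<^esub> t s = t g \<otimes>\<^bsub>TL\<^esub> t h"
    using assms(1) k s(1) Suc.hyps(2) by (simp add: TL.alg.m_assoc t_mult_ascent)
  finally show ?case .
qed

text \<open>
  The inverse of \<open>t\<^sub>s\<close>, obtained by solving \<open>t\<^sub>s\<^sup>2 = q + (q - 1) t\<^sub>s\<close>.
\<close>
definition t_gen_inv :: "'s list set \<Rightarrow> 'h set" where
  "t_gen_inv s = q_pow (-1) \<odot>\<^bsub>TL\<^esub> (t s \<oplus>\<^bsub>TL\<^esub> (1 - q_pow 1) \<odot>\<^bsub>TL\<^esub> \<one>\<^bsub>TL\<^esub>)"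

lemma t_gen_inv_closed [simp]: "s \<in> generators m \<Longrightarrow> t_gen_inv s \<in> carrier TL"
  by (simp add: t_gen_inv_def)

lemma t_gen_inv:
  assumes "s \<in> generators m"
  shows "t s \<otimes>\<^bsub>TL\<^esub> t_gen_inv s = \<one>\<^bsub>TL\<^esub>" "t_gen_inv s \<otimes>\<^bsub>TL\<^esub> t s = \<one>\<^bsub>TL\<^esub>"
proof -
  have "t s \<otimes>\<^bsub>TL\<^esub> t s = q_pow 1 \<odot>\<^bsub>TL\<^esub> \<one>\<^bsub>TL\<^esub> \<oplus>\<^bsub>TL\<^esub> (q_pow 1 - 1) \<odot>\<^bsub>TL\<^esub> t s"
    using t_mult_descent[of s s] assms
    by (simp add: generator_square cox_length_one cox_length_generator t_one)
  \<comment> \<open>The two scalars at \<open>t s\<close> are opposite; they are kept as a sum so that they cancel in the ground ring.\<close>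
  then have "t s \<otimes>\<^bsub>TL\<^esub> t s \<oplus>\<^bsub>TL\<^esub> (1 - q_pow 1) \<odot>\<^bsub>TL\<^esub> t s
      = q_pow 1 \<odot>\<^bsub>TL\<^esub> \<one>\<^bsub>TL\<^esub> \<oplus>\<^bsub>TL\<^esub> ((q_pow 1 - 1) + (1 - q_pow 1)) \<odot>\<^bsub>TL\<^esub> t s"
    using assms by (simp only: TL.smult_rules t_closed generator_in_carrier) (simp add: TL.a_assoc)
  then have "t s \<otimes>\<^bsub>TL\<^esub> t s \<oplus>\<^bsub>TL\<^esub> (1 - q_pow 1) \<odot>\<^bsub>TL\<^esub> t s = q_pow 1 \<odot>\<^bsub>TL\<^esub> \<one>\<^bsub>TL\<^esub>"
    using assms by (simp add: TL.smult_rules)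
  then have "q_pow (-1) \<odot>\<^bsub>TL\<^esub> (t s \<otimes>\<^bsub>TL\<^esub> t s \<oplus>\<^bsub>TL\<^esub> (1 - q_pow 1) \<odot>\<^bsub>TL\<^esub> t s) = \<one>\<^bsub>TL\<^esub>"
    using q_pow_inverse[of 1] by (simp add: TL.smult_rules)
  then show "t s \<otimes>\<^bsub>TL\<^esub> t_gen_inv s = \<one>\<^bsub>TL\<^esub>" "t_gen_inv s \<otimes>\<^bsub>TL\<^esub> t s = \<one>\<^bsub>TL\<^esub>"
    using assms by (simp_all add: t_gen_inv_def TL.smult_mult TL.alg.l_distr TL.alg.r_distr)
qed

lemma t_Units_generator:
  assumes "s \<in> generators m"
  shows "t s \<in> Units TL" "inv\<^bsub>TL\<^esub> (t s) = t_gen_inv s"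
proof -
  show "t s \<in> Units TL"
    unfolding Units_def using assms t_gen_inv[OF assms] by (auto intro!: bexI[of _ "t_gen_inv s"])
  show "inv\<^bsub>TL\<^esub> (t s) = t_gen_inv s"
    using TL.alg.inv_unique'[OF _ _ t_gen_inv[OF assms]] assms by simp
qed

lemma t_Units:
  assumes "w \<in> carrier W" shows "t w \<in> Units TL"
  using assms
proof (induction "cox_length w" arbitrary: w)
  case 0
  then show ?case using cox_length_0[of w] by (simp add: t_one)
next
  case (Suc n)
  obtain s where s: "s \<in> generators m" "cox_length (w \<otimes>\<^bsub>W\<^esub> s) = n"
    using descent_exists[OF Suc.prems] Suc.hyps(2) by metis
  then have "t w = t (w \<otimes>\<^bsub>W\<^esub> s) \<otimes>\<^bsub>TL\<^esub> t s"
    using t_mult_ascent[of "w \<otimes>\<^bsub>W\<^esub> s" s] Suc by (simp add: mult_generator_twice)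
  then show ?case
    using Suc s by (simp add: t_Units_generator TL.alg.Units_m_closed)
qed

lemma inv_t_inv_descent:
  assumes w: "w \<in> carrier W" and s: "s \<in> generators m"
    and less: "cox_length (w \<otimes>\<^bsub>W\<^esub> s) < cox_length w"
  shows "inv\<^bsub>TL\<^esub> t (inv\<^bsub>W\<^esub> w)
    = inv\<^bsub>TL\<^esub> t (inv\<^bsub>W\<^esub> (w \<otimes>\<^bsub>W\<^esub> s)) \<otimes>\<^bsub>TL\<^esub> t_gen_inv s"
proof -
  let ?v = "inv\<^bsub>W\<^esub> (w \<otimes>\<^bsub>W\<^esub> s)"
  have eq: "s \<otimes>\<^bsub>W\<^esub> ?v = inv\<^bsub>W\<^esub> w"
    using w s by (simp add: grp.inv_mult_group inv_generator generator_square flip: grp.m_assoc)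
  have "cox_length (s \<otimes>\<^bsub>W\<^esub> ?v) = cox_length s + cox_length ?v"
    using w s less cox_length_mult_generator[OF w s]
    by (simp add: eq cox_length_inv cox_length_generator)
  then have "t (inv\<^bsub>W\<^esub> w) = t s \<otimes>\<^bsub>TL\<^esub> t ?v"
    using t_mult[of s ?v] w s eq by simp
  then show ?thesis
    using w s by (simp add: TL.alg.inv_mult_Units t_Units t_Units_generator)
qed

section \<open>Linear combinations with polynomial coefficients\<close>

definition lincomb :: "'s list set set \<Rightarrow> ('s list set \<Rightarrow> int poly) \<Rightarrow> 'h set" where
  "lincomb B f = finsum TL (\<lambda>x. of_poly (f x) \<odot>\<^bsub>TL\<^esub> t x) B"

lemma TL_sum_lincomb: "TL_sum m H T w f = lincomb (fc_below m w) f"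
  by (simp add: TL_sum_def lincomb_def)

context
  fixes B :: "'s list set set"
  assumes B: "B \<subseteq> carrier W"
begin

lemma term_closed: "(\<lambda>x. of_poly (f x) \<odot>\<^bsub>TL\<^esub> t x) \<in> B \<rightarrow> carrier TL"
  using B by auto

lemma lincomb_closed [simp]: "lincomb B f \<in> carrier TL"
  unfolding lincomb_def by (rule TL.finsum_closed[OF term_closed])

lemma lincomb_cong: "(\<And>x. x \<in> B \<Longrightarrow> f x = g x) \<Longrightarrow> lincomb B f = lincomb B g"
  unfolding lincomb_def by (rule TL.finsum_cong') (use B in auto)

lemma lincomb_add: "lincomb B f \<oplus>\<^bsub>TL\<^esub> lincomb B g = lincomb B (\<lambda>x. f x + g x)"
proof -
  have "lincomb B (\<lambda>x. f x + g x)
      = finsum TL (\<lambda>x. of_poly (f x) \<odot>\<^bsub>TL\<^esub> t x \<oplus>\<^bsub>TL\<^esub> of_poly (g x) \<odot>\<^bsub>TL\<^esub> t x) B"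
    unfolding lincomb_def by (rule TL.finsum_cong') (use B in \<open>auto simp: TL.smult_rules\<close>)
  then show ?thesis
    by (simp add: lincomb_def TL.finsum_addf term_closed)
qed

lemma lincomb_smult:
  assumes "finite B" shows "of_poly c \<odot>\<^bsub>TL\<^esub> lincomb B f = lincomb B (\<lambda>x. c * f x)"
proof -
  have "lincomb B (\<lambda>x. c * f x) = finsum TL (\<lambda>x. of_poly c \<odot>\<^bsub>TL\<^esub> (of_poly (f x) \<odot>\<^bsub>TL\<^esub> t x)) B"
    unfolding lincomb_def by (rule TL.finsum_cong') (use B in \<open>auto simp: TL.smult_rules\<close>)
  then show ?thesis
    using TL.finsum_smult_ldistr[OF assms _ term_closed] by (simp add: lincomb_def)
qed

lemma lincomb_mono_neutral:
  assumes "finite B" "C \<subseteq> B" "\<And>x. x \<in> B - C \<Longrightarrow> f x = 0"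
  shows "lincomb C f = lincomb B f"
  unfolding lincomb_def
  using assms B by (intro TL.add.finprod_mono_neutral_cong_left) (auto simp: TL.smult_rules)

lemma lincomb_single:
  assumes "finite B" "y \<in> B" shows "lincomb B (\<lambda>x. if x = y then 1 else 0) = t y"
proof -
  have "y \<in> carrier W" using assms(2) B by blast
  then have "lincomb {y} (\<lambda>x. if x = y then 1 else 0) = t y"
    by (simp add: lincomb_def TL.smult_rules)
  then show ?thesis
    using assms lincomb_mono_neutral[of "{y}" "\<lambda>x. if x = y then 1 else 0"] by simp
qed

lemma lincomb_sum:
  assumes "finite B" "finite C"
  shows "finsum TL (\<lambda>y. of_poly (c y) \<odot>\<^bsub>TL\<^esub> lincomb B (M y)) C
    = lincomb B (\<lambda>x. \<Sum>y\<in>C. c y * M y x)"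
  using assms(2)
proof (induction C)
  case empty
  have "lincomb B (\<lambda>x. 0) = lincomb {} (\<lambda>x. 0)"
    by (rule lincomb_mono_neutral[symmetric]) (use assms in auto)
  then show ?case by (simp add: lincomb_def)
next
  case (insert y C)
  then show ?case by (simp add: lincomb_smult[OF assms(1)] lincomb_add)
qed

end

lemma fc_below_carrier: "fc_below m w \<subseteq> carrier W"
  by (auto simp: fc_below_def)

lemma finite_fc_below: "w \<in> carrier W \<Longrightarrow> finite (fc_below m w)"
  by (rule finite_subset[OF _ finite_bruhat_interval[of w]]) (auto simp: fc_below_def)

section \<open>The recursion\<close>

context
  fixes w s :: "'s list set"
  assumes w: "w \<in> fully_commutative m" and s: "s \<in> generators m"
    and less: "cox_length (w \<otimes>\<^bsub>W\<^esub> s) < cox_length w"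
begin

text \<open>
  This keeps the expansion of \<open>t\<^sub>y t\<^sub>s\<close> for \<open>y \<le> ws\<close> inside the interval below \<open>w\<close>.
\<close>

lemma bruhat_le_mult_generator:
  assumes "bruhat_le m y (w \<otimes>\<^bsub>W\<^esub> s)" "y \<in> carrier W"
  shows "bruhat_le m y w" "bruhat_le m (y \<otimes>\<^bsub>W\<^esub> s) w"
proof -
  have ws: "bruhat_le m (w \<otimes>\<^bsub>W\<^esub> s) w"
    using bruhat_less_mult_generator(2)[of w s] w s less by (simp add: bruhat_less_def)
  then show "bruhat_le m y w" using assms bruhat_le_trans by blast
  have "bruhat_le m (y \<otimes>\<^bsub>W\<^esub> s) (w \<otimes>\<^bsub>W\<^esub> s) \<or> bruhat_le m (y \<otimes>\<^bsub>W\<^esub> s) w"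
    using bruhat_lifting[OF assms s] w s by (simp add: mult_generator_twice)
  then show "bruhat_le m (y \<otimes>\<^bsub>W\<^esub> s) w" using ws bruhat_le_trans by blast
qed

text \<open>
  The coefficient at \<open>t\<^sub>x\<close> of \<open>t\<^sub>y t\<^sub>s + (1 - q) t\<^sub>y = q t\<^sub>y t\<^sub>s\<inverse>\<close>, with \<open>q\<close> written as \<open>[:0, 1:]\<close>.
\<close>
definition matrix_coeff ::
  "('s list set \<Rightarrow> 's list set \<Rightarrow> int poly) \<Rightarrow> 's list set \<Rightarrow> 's list set \<Rightarrow> int poly" where
  "matrix_coeff D y x =
     (if cox_length (y \<otimes>\<^bsub>W\<^esub> s) < cox_length y then [:0, 1:] * (if x = y \<otimes>\<^bsub>W\<^esub> s then 1 else 0)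
      else (if y \<otimes>\<^bsub>W\<^esub> s \<in> fully_commutative m then if x = y \<otimes>\<^bsub>W\<^esub> s then 1 else 0
            else D x (y \<otimes>\<^bsub>W\<^esub> s))
        + (1 - [:0, 1:]) * (if x = y then 1 else 0))"

text \<open>
  In the descending case the summand \<open>(q - 1) t\<^sub>y\<close> of \<open>t\<^sub>y t\<^sub>s\<close> cancels. In the ascending case \<open>t\<^sub>y t\<^sub>s = t\<^bsub>ys\<^esub>\<close>,
  which is one of the \<open>t\<^sub>x\<close> or is expanded by the polynomials \<open>D\<close>; the latter vanish on the elements that are
  below \<open>w\<close> but not below \<open>ys\<close>.
\<close>

lemma t_mult_lincomb:
  assumes D: "is_D_family m H T D" and y: "y \<in> fc_below m (w \<otimes>\<^bsub>W\<^esub> s)"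
  shows "t y \<otimes>\<^bsub>TL\<^esub> t s \<oplus>\<^bsub>TL\<^esub> (1 - q_pow 1) \<odot>\<^bsub>TL\<^esub> t y = lincomb (fc_below m w) (matrix_coeff D y)"
proof -
  let ?B = "fc_below m w" and ?ys = "y \<otimes>\<^bsub>W\<^esub> s" and ?\<delta> = "\<lambda>y x. if x = y then 1 else 0 :: int poly"
  have fin: "finite ?B" using w by (simp add: finite_fc_below)
  note B = fc_below_carrier[of w]
  have y': "y \<in> fully_commutative m" "y \<in> carrier W" "?ys \<in> carrier W"
    using y s by (auto simp: fc_below_def)
  have below: "bruhat_le m y w" "bruhat_le m ?ys w"
    using bruhat_le_mult_generator y y'(2) by (auto simp: fc_below_def)
  then have yB: "y \<in> ?B" using y' by (simp add: fc_below_def)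
  have ysB: "?ys \<in> ?B" if "?ys \<in> fully_commutative m" using below that by (simp add: fc_below_def)
  show ?thesis
  proof (cases "cox_length ?ys < cox_length y")
    case True
    then have "?ys \<in> ?B" using ysB fully_commutative_mult_generator y'(1) s by blast
    have "t y \<otimes>\<^bsub>TL\<^esub> t s \<oplus>\<^bsub>TL\<^esub> (1 - q_pow 1) \<odot>\<^bsub>TL\<^esub> t y
        = q_pow 1 \<odot>\<^bsub>TL\<^esub> t ?ys \<oplus>\<^bsub>TL\<^esub> ((q_pow 1 - 1) + (1 - q_pow 1)) \<odot>\<^bsub>TL\<^esub> t y"
      using t_mult_descent[OF y'(2) s True] y'
      by (simp only: TL.smult_rules t_closed) (simp add: TL.a_assoc)
    also have "\<dots> = of_poly [:0, 1:] \<odot>\<^bsub>TL\<^esub> lincomb ?B (?\<delta> ?ys)"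
      using y' by (simp add: TL.smult_rules lincomb_single[OF B fin \<open>?ys \<in> ?B\<close>])
    also have "\<dots> = lincomb ?B (matrix_coeff D y)"
      using True unfolding lincomb_smult[OF B fin] by (intro lincomb_cong[OF B]) (simp add: matrix_coeff_def)
    finally show ?thesis .
  next
    case False
    let ?f = "if ?ys \<in> fully_commutative m then ?\<delta> ?ys else (\<lambda>x. D x ?ys)"
    have "t ?ys = lincomb ?B ?f"
    proof (cases "?ys \<in> fully_commutative m")
      case True
      then show ?thesis using lincomb_single[OF B fin ysB] by simp
    next
      case False
      have "t ?ys = lincomb (fc_below m ?ys) (\<lambda>x. D x ?ys)"
        using D y'(3) by (simp add: is_D_family_def TL_sum_lincomb)
      also have "\<dots> = lincomb ?B (\<lambda>x. D x ?ys)"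
        using below(2) bruhat_le_trans D y'(3)
        by (intro lincomb_mono_neutral[OF B fin]) (auto simp: fc_below_def is_D_family_def)
      finally show ?thesis using False by simp
    qed
    moreover have "t y \<otimes>\<^bsub>TL\<^esub> t s = t ?ys"
      using False cox_length_mult_generator[OF y'(2) s] by (intro t_mult_ascent[OF y'(2) s]) auto
    moreover have "(1 - q_pow 1) \<odot>\<^bsub>TL\<^esub> t y = lincomb ?B (\<lambda>x. (1 - [:0, 1:]) * ?\<delta> y x)"
      using lincomb_smult[OF B fin, of "1 - [:0, 1:]" "?\<delta> y"] by (simp add: lincomb_single[OF B fin yB])
    ultimately have "t y \<otimes>\<^bsub>TL\<^esub> t s \<oplus>\<^bsub>TL\<^esub> (1 - q_pow 1) \<odot>\<^bsub>TL\<^esub> t y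
        = lincomb ?B (\<lambda>x. ?f x + (1 - [:0, 1:]) * ?\<delta> y x)"
      by (simp add: lincomb_add[OF B])
    also have "\<dots> = lincomb ?B (matrix_coeff D y)"
      using False by (intro lincomb_cong[OF B]) (simp add: matrix_coeff_def)
    finally show ?thesis .
  qed
qed

lemma inv_t_inv_expansion:
  assumes D: "is_D_family m H T D" and a: "is_a_family m H T a"
    and ws: "w \<otimes>\<^bsub>W\<^esub> s \<in> fully_commutative m"
  shows "inv\<^bsub>TL\<^esub> t (inv\<^bsub>W\<^esub> w) = q_pow (- int (cox_length w)) \<odot>\<^bsub>TL\<^esub>
    lincomb (fc_below m w) (\<lambda>x. \<Sum>y\<in>fc_below m (w \<otimes>\<^bsub>W\<^esub> s). a y (w \<otimes>\<^bsub>W\<^esub> s) * matrix_coeff D y x)"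
proof -
  let ?ws = "w \<otimes>\<^bsub>W\<^esub> s" and ?a = "\<lambda>y. a y (w \<otimes>\<^bsub>W\<^esub> s)"
  let ?B = "fc_below m w" and ?C = "fc_below m ?ws"
  let ?e = "t s \<oplus>\<^bsub>TL\<^esub> (1 - q_pow 1) \<odot>\<^bsub>TL\<^esub> \<one>\<^bsub>TL\<^esub>"
  note B = fc_below_carrier[of w] and C = fc_below_carrier[of ?ws]
  have fin: "finite ?B" "finite ?C" using w s by (simp_all add: finite_fc_below)
  have e: "?e \<in> carrier TL" using s by simp
  have tC: "t y \<in> carrier TL" if "y \<in> ?C" for y using C that by auto
  have len: "- int (cox_length w) = - int (cox_length ?ws) + - 1"
    using cox_length_mult_generator[of w s] w s less by simp
  have "inv\<^bsub>TL\<^esub> t (inv\<^bsub>W\<^esub> ?ws) = q_pow (- int (cox_length ?ws)) \<odot>\<^bsub>TL\<^esub> lincomb ?C ?a"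
    using a ws by (simp add: is_a_family_def Let_def TL_sum_lincomb)
  then have "inv\<^bsub>TL\<^esub> t (inv\<^bsub>W\<^esub> w)
      = (q_pow (- int (cox_length ?ws)) \<odot>\<^bsub>TL\<^esub> lincomb ?C ?a) \<otimes>\<^bsub>TL\<^esub> (q_pow (-1) \<odot>\<^bsub>TL\<^esub> ?e)"
    using inv_t_inv_descent[OF _ s less] w by (simp add: t_gen_inv_def)
  also have "\<dots> = q_pow (- int (cox_length w)) \<odot>\<^bsub>TL\<^esub> (lincomb ?C ?a \<otimes>\<^bsub>TL\<^esub> ?e)"
    using e C unfolding len q_pow_add by (simp add: TL.smult_mult TL.smult_rules mult.commute)
  also have "lincomb ?C ?a \<otimes>\<^bsub>TL\<^esub> ?e = finsum TL (\<lambda>y. (of_poly (?a y) \<odot>\<^bsub>TL\<^esub> t y) \<otimes>\<^bsub>TL\<^esub> ?e) ?C"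
    unfolding lincomb_def using term_closed[OF C] e fin by (intro TL.alg.finsum_ldistr) auto
  also have "\<dots> = finsum TL (\<lambda>y. of_poly (?a y) \<odot>\<^bsub>TL\<^esub> lincomb ?B (matrix_coeff D y)) ?C"
  proof (rule TL.finsum_cong')
    fix y assume y: "y \<in> ?C"
    have "(of_poly (?a y) \<odot>\<^bsub>TL\<^esub> t y) \<otimes>\<^bsub>TL\<^esub> ?e
        = of_poly (?a y) \<odot>\<^bsub>TL\<^esub> (t y \<otimes>\<^bsub>TL\<^esub> t s \<oplus>\<^bsub>TL\<^esub> (1 - q_pow 1) \<odot>\<^bsub>TL\<^esub> t y)"
      using tC[OF y] s by (simp add: TL.smult_mult TL.alg.r_distr TL.smult_rules mult.commute)
    then show "(of_poly (?a y) \<odot>\<^bsub>TL\<^esub> t y) \<otimes>\<^bsub>TL\<^esub> ?e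
        = of_poly (?a y) \<odot>\<^bsub>TL\<^esub> lincomb ?B (matrix_coeff D y)"
      by (simp only: t_mult_lincomb[OF D y])
  qed (use B in auto)
  also have "\<dots> = lincomb ?B (\<lambda>x. \<Sum>y\<in>?C. ?a y * matrix_coeff D y x)"
    by (rule lincomb_sum[OF B fin])
  finally show ?thesis .
qed

text \<open>
  Only \<open>y = x\<close>, \<open>y = xs\<close> and the \<open>y\<close> with \<open>ys\<close> not fully commutative contribute. If \<open>x\<close> or \<open>xs\<close> is fully
  commutative but not below \<open>ws\<close>, its contribution is missing from the sum, and the corresponding value of
  \<open>a\<close> is \<open>0\<close>.
\<close>

lemma sum_matrix_coeff:
  assumes a: "is_a_family m H T a" and ws: "w \<otimes>\<^bsub>W\<^esub> s \<in> fully_commutative m"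
    and x: "x \<in> fully_commutative m"
  shows "(\<Sum>y\<in>fc_below m (w \<otimes>\<^bsub>W\<^esub> s). a y (w \<otimes>\<^bsub>W\<^esub> s) * matrix_coeff D y x)
    = a_tilde m a s x w +
      (\<Sum>y | y \<in> fully_commutative m \<and> y \<otimes>\<^bsub>W\<^esub> s \<notin> fully_commutative m \<and>
             bruhat_less m y (y \<otimes>\<^bsub>W\<^esub> s) \<and> a y (w \<otimes>\<^bsub>W\<^esub> s) \<noteq> 0.
        D x (y \<otimes>\<^bsub>W\<^esub> s) * a y (w \<otimes>\<^bsub>W\<^esub> s))"
proof -
  let ?C = "fc_below m (w \<otimes>\<^bsub>W\<^esub> s)" and ?a = "\<lambda>y. a y (w \<otimes>\<^bsub>W\<^esub> s)" and ?xs = "x \<otimes>\<^bsub>W\<^esub> s"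
  let ?q = "[:0, 1:] :: int poly"
  define up where "up y \<longleftrightarrow> cox_length y < cox_length (y \<otimes>\<^bsub>W\<^esub> s)" for y
  define S where "S = {y. y \<in> fully_commutative m \<and> y \<otimes>\<^bsub>W\<^esub> s \<notin> fully_commutative m \<and>
             bruhat_less m y (y \<otimes>\<^bsub>W\<^esub> s) \<and> ?a y \<noteq> 0}"
  have fin: "finite ?C" using w s by (simp add: finite_fc_below)
  have x': "x \<in> carrier W" using x by simp
  have a0: "?a y = 0" if "y \<in> fully_commutative m" "y \<notin> ?C" for y
    using a ws that by (auto simp: is_a_family_def fc_below_def Let_def)
  have down: "cox_length (y \<otimes>\<^bsub>W\<^esub> s) < cox_length y \<longleftrightarrow> \<not> up y" if "y \<in> carrier W" for y
    using cox_length_mult_generator[OF that s] by (auto simp: up_def)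
  have up_xs: "up ?xs \<longleftrightarrow> \<not> up x"
    using down[OF x'] by (simp add: up_def mult_generator_twice x' s)
  have xs_FC: "?xs \<in> fully_commutative m" if "\<not> up x"
    using fully_commutative_mult_generator[OF x s] that down[OF x'] by simp
  have "(\<Sum>y\<in>?C. ?a y * matrix_coeff D y x) =
      (\<Sum>y\<in>?C. (if y = x then if up x then (1 - ?q) * ?a x else 0 else 0)
        + (if y = ?xs then if up x then ?q * ?a ?xs else ?a ?xs else 0)
        + (if up y \<and> y \<otimes>\<^bsub>W\<^esub> s \<notin> fully_commutative m then D x (y \<otimes>\<^bsub>W\<^esub> s) * ?a y else 0))"
  proof (rule sum.cong[OF HOL.refl])
    fix y assume "y \<in> ?C"
    then have y: "y \<in> fully_commutative m" "y \<in> carrier W" by (auto simp: fc_below_def)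
    have eq: "x = y \<otimes>\<^bsub>W\<^esub> s \<longleftrightarrow> y = ?xs"
      using mult_generator_twice[OF y(2) s] mult_generator_twice[OF x' s] by metis
    show "?a y * matrix_coeff D y x = (if y = x then if up x then (1 - ?q) * ?a x else 0 else 0)
        + (if y = ?xs then if up x then ?q * ?a ?xs else ?a ?xs else 0)
        + (if up y \<and> y \<otimes>\<^bsub>W\<^esub> s \<notin> fully_commutative m then D x (y \<otimes>\<^bsub>W\<^esub> s) * ?a y else 0)"
    proof (cases "y = ?xs")
      case True
      then have ys: "y \<otimes>\<^bsub>W\<^esub> s = x" and up: "up y \<longleftrightarrow> \<not> up x" using eq up_xs by simp_all
      moreover from up have "y \<noteq> x" by blast
      ultimately show ?thesis
        using x down[OF y(2)] by (simp add: matrix_coeff_def True[symmetric])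
    next
      case False
      then have "x \<noteq> y \<otimes>\<^bsub>W\<^esub> s" using eq by simp
      then show ?thesis
        using False y by (auto simp: matrix_coeff_def down algebra_simps)
    qed
  qed
  also have "\<dots> = (if up x then (1 - ?q) * ?a x else 0)
      + (if ?xs \<in> ?C then if up x then ?q * ?a ?xs else ?a ?xs else 0)
      + (\<Sum>y | y \<in> ?C \<and> up y \<and> y \<otimes>\<^bsub>W\<^esub> s \<notin> fully_commutative m. D x (y \<otimes>\<^bsub>W\<^esub> s) * ?a y)"
    using a0[OF x] by (auto simp: sum.distrib sum.delta[OF fin] sum.inter_filter[OF fin, symmetric])
  also have "(\<Sum>y | y \<in> ?C \<and> up y \<and> y \<otimes>\<^bsub>W\<^esub> s \<notin> fully_commutative m. D x (y \<otimes>\<^bsub>W\<^esub> s) * ?a y)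
      = (\<Sum>y\<in>S. D x (y \<otimes>\<^bsub>W\<^esub> s) * ?a y)"
  proof (rule sum.mono_neutral_right)
    show "finite {y. y \<in> ?C \<and> up y \<and> y \<otimes>\<^bsub>W\<^esub> s \<notin> fully_commutative m}"
      using fin by (rule rev_finite_subset) blast
  qed (use a0 s in \<open>auto simp: S_def up_def fc_below_def bruhat_less_mult_generator\<close>)
  also have "(if up x then (1 - ?q) * ?a x else 0)
      + (if ?xs \<in> ?C then if up x then ?q * ?a ?xs else ?a ?xs else 0) = a_tilde m a s x w"
  proof (cases "up x")
    case True
    then have "bruhat_less m x ?xs" "\<not> bruhat_less m ?xs x"
      using bruhat_less_mult_generator[OF x' s] by (auto simp: up_def)
    moreover have "?xs \<in> fully_commutative m" if "?xs \<in> ?C" using that by (simp add: fc_below_def)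
    ultimately show ?thesis
      using True a0[of ?xs] by (auto simp: a_tilde_def Let_def)
  next
    case False
    then have "bruhat_less m ?xs x"
      using bruhat_less_mult_generator[OF x' s] down[OF x'] by simp
    then show ?thesis
      using False a0[of ?xs] xs_FC by (auto simp: a_tilde_def Let_def)
  qed
  finally show ?thesis by (simp add: S_def)
qed

end

end

theorem proposition2p5:
  fixes m :: "'s \<Rightarrow> 's \<Rightarrow> enat"
    and H :: "(laurent, 'h) module"
    and T :: "'s list set \<Rightarrow> 'h"
    and D a :: "'s list set \<Rightarrow> 's list set \<Rightarrow> int poly"
    and w s x :: "'s list set"
  assumes "coxeter_graph m"
    and "hecke_algebra m H T"
    and "is_D_family m H T D"
    and "is_a_family m H T a"
    and "w \<in> fully_commutative m"
    and "s \<in> generators m"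
    and "bruhat_less m (w \<otimes>\<^bsub>coxeter_group m\<^esub> s) w"
    and "w \<otimes>\<^bsub>coxeter_group m\<^esub> s \<in> fully_commutative m"
    and "x \<in> fully_commutative m"
    and "bruhat_le m x w"
  shows "a x w = a_tilde m a s x w +
      (\<Sum>y | y \<in> fully_commutative m \<and>
             y \<otimes>\<^bsub>coxeter_group m\<^esub> s \<notin> fully_commutative m \<and>
             bruhat_less m y (y \<otimes>\<^bsub>coxeter_group m\<^esub> s) \<and>
             a y (w \<otimes>\<^bsub>coxeter_group m\<^esub> s) \<noteq> 0.
        D x (y \<otimes>\<^bsub>coxeter_group m\<^esub> s) * a y (w \<otimes>\<^bsub>coxeter_group m\<^esub> s))"
proof -
  interpret temperley_lieb m H T
    using assms by unfold_locales
  have less: "cox_length (w \<otimes>\<^bsub>W\<^esub> s) < cox_length w"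
    using assms by (simp add: bruhat_less_cox_length)
  note at = assms(5,6) less
  let ?F = "\<lambda>x. \<Sum>y\<in>fc_below m (w \<otimes>\<^bsub>W\<^esub> s). a y (w \<otimes>\<^bsub>W\<^esub> s) * matrix_coeff s D y x"
  have "inv\<^bsub>TL\<^esub> t (inv\<^bsub>W\<^esub> w) = q_pow (- int (cox_length w)) \<odot>\<^bsub>TL\<^esub> TL_sum m H T w ?F"
    using inv_t_inv_expansion[OF at assms(3,4,8)] by (simp add: TL_sum_lincomb)
  then have "?F x = a x w"
    using assms(4,5,9,10) by (simp add: is_a_family_def Let_def fc_below_def)
  then show ?thesis
    using sum_matrix_coeff[OF at assms(4,8,9)] by simp
qed

end
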